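(* There exist positive constants $C$ and $r_0$ such that for all $r\ge r_0$, \[ 2^{\log^2 r/36} \le F_\chi(r,4,3) \le C\cdot 2^{130\sqrt{r\log r}}. \]
   Context: Logarithms are base 2. A graph is $p$-chromatic if its chromatic number is exactly $p$. For $p\ge3$, $2\le q\le\binom p2$ and positive integer $r$, $F_\chi(r,p,q)$ is the minimum integer $n$ such that every edge coloring of $K_n$ with $r$ colors contains a $p$-chromatic subgraph whose edges receive at most $q-1$ distinct colors. *)

theory Defs
  imports Complex_Main
begin

definition edges_of :: "nat set \<Rightarrow> nat set set" where
  "edges_of V = {e. \<exists>u\<in>V. \<exists>v\<in>V. u \<noteq> v \<and> e = {u, v}}"

definition proper_colouring :: "nat set \<Rightarrow> nat set set \<Rightarrow> (nat \<Rightarrow> nat) \<Rightarrow> nat \<Rightarrow> bool" where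
  "proper_colouring V E f k \<longleftrightarrow>
     f ` V \<subseteq> {..<k} \<and> (\<forall>u v. {u, v} \<in> E \<longrightarrow> u \<noteq> v \<longrightarrow> f u \<noteq> f v)"

definition chromatic_number :: "nat set \<Rightarrow> nat set set \<Rightarrow> nat" where
  "chromatic_number V E = (LEAST k. \<exists>f. proper_colouring V E f k)"

definition F_chi :: "nat \<Rightarrow> nat \<Rightarrow> nat \<Rightarrow> nat" where
  "F_chi r p q = (LEAST n. \<forall>c :: nat set \<Rightarrow> nat.
      c ` edges_of {..<n} \<subseteq> {..<r} \<longrightarrow>
      (\<exists>V E. V \<subseteq> {..<n} \<and> E \<subseteq> edges_of V \<and> chromatic_number V E = p
             \<and> card (c ` E) \<le> q - 1))"

end

theory Submission
  imports Defs "HOL-Library.FuncSet" "HOL-Real_Asymp.Real_Asymp"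
begin

text \<open>
  Lower bound: colour an edge of the grid of all functions from \<open>{..<t}\<close> to \<open>{..<m}\<close> by the set of
  coordinates in which its ends differ together with the two values at the first such coordinate
  (Mubayi). The union of two colour classes maps homomorphically to a graph on the values at
  the two first coordinates, which is 3-colourable.

  Upper bound: suppose that any two colours together are 3-colourable. Among all pairs \<open>(P, Q)\<close> of
  vertex sets maximise \<open>|P| |Q| d\<^sup>N 2\<^bsup>-(8/q)k\<^esup>\<close>, where \<open>N = 32q\<close>, \<open>d\<close> is the density between \<open>P\<close> and \<open>Q\<close>
  of a fixed popular colour \<open>i\<close>, and \<open>k\<close> is the number of colours that occur inside both \<open>P\<close> and \<open>Q\<close>.
  Disjoint \<open>i\<close>-free blocks \<open>P\<^sub>l \<times> Q\<^sub>l\<close> can be cut into two halves so that only off-diagonal products remain,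
  which raises the density; hence there are fewer than \<open>2q\<close> of them, and after deleting them every
  large \<open>P' \<times> Q'\<close> contains an edge of colour \<open>i\<close>. A 3-colouring of the union of \<open>i\<close> with another colour
  then has, on \<open>P\<close> or on \<open>Q\<close>, two small classes, and deleting these removes the other colour from that
  side. Doing this for \<open>q\<close> colours at once costs a bounded factor, so at the maximum \<open>k \<le> q\<close> and all
  common colours can be removed. One of the two sides is left with at most half of the colours; with
  \<open>q\<close> of order \<open>\<surd>(r / log r)\<close> the loss is \<open>2\<^bsup>O(\<surd>(r log r))\<^esup>\<close>, and iterating gives a geometric sum.
\<close>

section \<open>Balanced cuts\<close>

lemma card_subsets_in_out:
  assumes "finite B" "l \<in> B" "l' \<in> B" "l \<noteq> l'" "q \<ge> 1"
  shows "card {R. R \<subseteq> B \<and> card R = q \<and> l \<in> R \<and> l' \<notin> R} = (card B - 2) choose (q - 1)"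
proof -
  let ?S = "{R. R \<subseteq> B - {l, l'} \<and> card R = q - 1}"
  have fin: "finite R" if "R \<subseteq> B" for R
    using that assms(1) finite_subset by blast
  have "bij_betw (insert l) ?S {R. R \<subseteq> B \<and> card R = q \<and> l \<in> R \<and> l' \<notin> R}"
  proof (rule bij_betw_byWitness[where f' = "\<lambda>R. R - {l}"])
    show "insert l ` ?S \<subseteq> {R. R \<subseteq> B \<and> card R = q \<and> l \<in> R \<and> l' \<notin> R}"
    proof
      fix R' assume "R' \<in> insert l ` ?S"
      then obtain R where R: "R \<subseteq> B - {l, l'}" "card R = q - 1" "R' = insert l R" by auto
      then have "finite R" using fin by blast
      moreover have "l \<notin> R" using R by auto
      ultimately have "card R' = q" using R assms(5) by simp
      then show "R' \<in> {R. R \<subseteq> B \<and> card R = q \<and> l \<in> R \<and> l' \<notin> R}"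
        using R assms by auto
    qed
  qed (use assms(4) fin in \<open>auto simp: insert_absorb\<close>)
  then have "card {R. R \<subseteq> B \<and> card R = q \<and> l \<in> R \<and> l' \<notin> R} = card ?S"
    by (simp add: bij_betw_same_card)
  also have "\<dots> = card (B - {l, l'}) choose (q - 1)"
    using assms(1) by (intro n_subsets) auto
  also have "card (B - {l, l'}) = card B - 2"
    using assms by (subst card_Diff_subset) auto
  finally show ?thesis .
qed

text \<open>So \<open>(2 * q - 2) choose (q - 1)\<close> divided by \<open>(2 * q) choose q\<close>
  is q / (2 (2q - 1)), the probability that a random half of 2q points contains one given point and
  misses another. Two absorptions and one symmetry give it.\<close>

lemma central_binomial_step:
  assumes "q \<ge> 1"
  shows "q * ((2 * q) choose q) = 2 * (2 * q - 1) * ((2 * q - 2) choose (q - 1))"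
proof -
  obtain p where p: "q = Suc p" using assms by (cases q) auto
  have "q * ((2 * q) choose q) = Suc p * (Suc (Suc (2 * p)) choose Suc p)"
    unfolding p by (simp del: binomial_Suc_Suc)
  also have "\<dots> = Suc (Suc (2 * p)) * (Suc (2 * p) choose p)"
    by (rule Suc_times_binomial)
  also have "Suc (2 * p) choose p = Suc (2 * p) choose Suc p"
    using binomial_symmetric[of p "Suc (2 * p)"] by (simp del: binomial_Suc_Suc)
  also have "Suc (Suc (2 * p)) * \<dots> = 2 * (Suc p * (Suc (2 * p) choose Suc p))"
    by (simp del: binomial_Suc_Suc)
  also have "Suc p * (Suc (2 * p) choose Suc p) = Suc (2 * p) * ((2 * p) choose p)"
    by (rule Suc_times_binomial)
  finally show ?thesis unfolding p by simp
qed

text \<open>Averaging over all halves \<open>R\<close>: an ordered pair of distinct points is cut in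
  the right direction with probability q / (2 (2q - 1)), and the zero diagonal lets the full double
  sum stand for the distinct pairs. This probability exceeds 1/4, the value for an unrestricted
  random cut, and the excess is the gain used later.\<close>

lemma balanced_cut:
  fixes w :: "'a \<Rightarrow> 'a \<Rightarrow> real"
  assumes fin: "finite B" and card: "card B = 2 * q" and q: "q \<ge> 1"
    and diag: "\<And>l. l \<in> B \<Longrightarrow> w l l = 0"
  shows "\<exists>R\<subseteq>B. card R = q \<and>
    real q * (\<Sum>l\<in>B. \<Sum>l'\<in>B. w l l') \<le> real (2 * (2 * q - 1)) * (\<Sum>l\<in>R. \<Sum>l'\<in>B - R. w l l')"
proof (rule ccontr)
  let ?F = "{R. R \<subseteq> B \<and> card R = q}"
  let ?W = "\<Sum>l\<in>B. \<Sum>l'\<in>B. w l l'"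
  let ?w = "\<lambda>R. \<Sum>l\<in>R. \<Sum>l'\<in>B - R. w l l'"
  let ?c = "(2 * q - 2) choose (q - 1)"
  assume "\<not> ?thesis"
  then have lt: "\<And>R. R \<in> ?F \<Longrightarrow> real (2 * (2 * q - 1)) * ?w R < real q * ?W" by force
  have finF: "finite ?F" using fin by auto
  have cardF: "card ?F = (2 * q) choose q" using n_subsets[OF fin, of q] card by simp
  then have "?F \<noteq> {}" using zero_less_binomial[of q "2 * q"] by (metis card.empty less_irrefl le_add2 mult_2)
  \<comment> \<open>If every half were below the average, so would be their sum; counting that sum
    pair by pair gives equality instead.\<close>
  then have "(\<Sum>R\<in>?F. real (2 * (2 * q - 1)) * ?w R) < (\<Sum>R\<in>?F. real q * ?W)"
    using lt finF by (intro sum_strict_mono) auto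
  then have A: "real (2 * (2 * q - 1)) * (\<Sum>R\<in>?F. ?w R) < real q * real ((2 * q) choose q) * ?W"
    unfolding sum_distrib_left[symmetric] sum_constant cardF by (simp only: mult_ac)
  have "(\<Sum>R\<in>?F. ?w R) = (\<Sum>R\<in>?F. \<Sum>l\<in>B. \<Sum>l'\<in>B. if l \<in> R \<and> l' \<notin> R then w l l' else 0)"
  proof (rule sum.cong[OF refl])
    fix R assume R: "R \<in> ?F"
    have "?w R = (\<Sum>l\<in>B. if l \<in> R then \<Sum>l'\<in>B - R. w l l' else 0)"
      using fin R by (simp add: sum.If_cases Int_absorb1)
    also have "\<dots> = (\<Sum>l\<in>B. \<Sum>l'\<in>B. if l \<in> R \<and> l' \<notin> R then w l l' else 0)"
      using fin by (intro sum.cong) (auto simp: sum.If_cases Diff_eq Collect_neg_eq)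
    finally show "?w R = (\<Sum>l\<in>B. \<Sum>l'\<in>B. if l \<in> R \<and> l' \<notin> R then w l l' else 0)" .
  qed
  also have "\<dots> = (\<Sum>l\<in>B. \<Sum>l'\<in>B. \<Sum>R\<in>?F. if l \<in> R \<and> l' \<notin> R then w l l' else 0)"
    by (subst sum.swap, rule sum.cong[OF refl], rule sum.swap)
  also have "\<dots> = (\<Sum>l\<in>B. \<Sum>l'\<in>B. w l l' * real ?c)"
  proof (intro sum.cong refl)
    fix l l' assume l: "l \<in> B" "l' \<in> B"
    have "(\<Sum>R\<in>?F. if l \<in> R \<and> l' \<notin> R then w l l' else 0)
        = w l l' * real (card {R. R \<subseteq> B \<and> card R = q \<and> l \<in> R \<and> l' \<notin> R})"
      using finF by (simp add: sum.If_cases Collect_conj_eq[symmetric] conj_assoc mult.commute)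
    also have "\<dots> = w l l' * real ?c"
      using card_subsets_in_out[OF fin l _ q] card diag l by (cases "l = l'") auto
    finally show "(\<Sum>R\<in>?F. if l \<in> R \<and> l' \<notin> R then w l l' else 0) = w l l' * real ?c" .
  qed
  finally have S: "(\<Sum>R\<in>?F. ?w R) = ?W * real ?c" by (simp add: sum_distrib_right)
  have "real q * real ((2 * q) choose q) = real (2 * (2 * q - 1)) * real ?c"
    using arg_cong[OF central_binomial_step[OF q], of real] by (simp only: of_nat_mult)
  then have "real (2 * (2 * q - 1)) * (\<Sum>R\<in>?F. ?w R) = real q * real ((2 * q) choose q) * ?W"
    unfolding S by (simp only: mult_ac)
  with A show False by simp
qed

section \<open>Pairs of maximal density\<close>

text \<open>Division by zero makes the density 0 when a side is empty or infinite.\<close>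

definition dens :: "('a \<times> 'b) set \<Rightarrow> 'a set \<Rightarrow> 'b set \<Rightarrow> real" where
  "dens E P Q = real (card (E \<inter> P \<times> Q)) / (real (card P) * real (card Q))"

text \<open>
  Passing to a subrectangle gains a factor \<open>y\<close> of density only if its size drops by a factor of
  at least \<open>y\<^sup>N\<close>.
\<close>

definition dense_max :: "('a \<times> 'b) set \<Rightarrow> 'a set \<Rightarrow> 'b set \<Rightarrow> nat \<Rightarrow> bool" where
  "dense_max E P Q N \<longleftrightarrow> (\<forall>P' Q'. P' \<subseteq> P \<longrightarrow> Q' \<subseteq> Q \<longrightarrow> P' \<noteq> {} \<longrightarrow> Q' \<noteq> {} \<longrightarrow>
     real (card P') * real (card Q') * dens E P' Q' ^ N \<le> real (card P) * real (card Q) * dens E P Q ^ N)"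

lemma dens_nonneg [simp]: "dens E P Q \<ge> 0"
  by (simp add: dens_def)

lemma dens_le_1: "dens E P Q \<le> 1"
proof (cases "finite P \<and> finite Q \<and> P \<noteq> {} \<and> Q \<noteq> {}")
  case True
  then have "card (E \<inter> P \<times> Q) \<le> card (P \<times> Q)" by (intro card_mono) auto
  also have "\<dots> = card P * card Q" by (rule card_cartesian_product)
  finally have "real (card (E \<inter> P \<times> Q)) \<le> real (card P) * real (card Q)"
    by (metis of_nat_le_iff of_nat_mult)
  then show ?thesis using True by (simp add: dens_def divide_le_eq card_gt_0_iff)
next
  case False
  then show ?thesis by (auto simp: dens_def)
qed

lemma edges_eq_dens:
  assumes "finite P" "finite Q"
  shows "real (card (E \<inter> P \<times> Q)) = dens E P Q * (real (card P) * real (card Q))"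
  using assms by (cases "P = {} \<or> Q = {}") (auto simp: dens_def)

text \<open>N-th roots are taken in the maximality inequality. The conclusion counts edges because
  counts, unlike densities, add up when a rectangle is cut into pieces.\<close>

lemma dense_maxD:
  assumes M: "dense_max E P Q N" and fin: "finite P" "finite Q"
    and sub: "P' \<subseteq> P" "Q' \<subseteq> Q" and ne: "P' \<noteq> {}" "Q' \<noteq> {}" and y: "y \<ge> 0" and N: "N > 0"
    and le: "real (card P) * real (card Q) \<le> y ^ N * (real (card P') * real (card Q'))"
  shows "real (card (E \<inter> P' \<times> Q')) \<le> y * dens E P Q * (real (card P') * real (card Q'))"
proof -
  let ?c = "real (card P') * real (card Q')"
  have fin': "finite P'" "finite Q'" using fin sub finite_subset by blast+
  then have c: "?c > 0" using ne by (simp add: card_gt_0_iff)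
  have "?c * dens E P' Q' ^ N \<le> real (card P) * real (card Q) * dens E P Q ^ N"
    using M sub ne unfolding dense_max_def by blast
  also have "\<dots> \<le> (y ^ N * ?c) * dens E P Q ^ N"
    using le by (intro mult_right_mono) auto
  also have "\<dots> = ?c * (y * dens E P Q) ^ N" by (simp add: power_mult_distrib)
  finally have "dens E P' Q' ^ N \<le> (y * dens E P Q) ^ N"
    using c mult_le_cancel_left_pos by blast
  then have "dens E P' Q' \<le> y * dens E P Q"
    using N y by (meson dens_nonneg mult_nonneg_nonneg power_mono_iff)
  then have "dens E P' Q' * ?c \<le> y * dens E P Q * ?c"
    using c by (intro mult_right_mono) auto
  then show ?thesis using edges_eq_dens[OF fin'] by simp
qed

text \<open>Bernoulli's inequality for the exponent \<open>q\<close>, raised to the power 32. It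
  reduces estimates with exponent \<open>32 * q\<close> to one computation that is uniform in
  \<open>q\<close>. Negative \<open>c\<close> serves the lower bound in
  \<open>half_density\<close>.\<close>

lemma Bernoulli_32:
  fixes c :: real
  assumes "q \<ge> 1" "c \<ge> -32"
  shows "(1 + c / 32) ^ 32 \<le> (1 + c / real (32 * q)) ^ (32 * q)"
proof -
  have "-1 \<le> c / real (32 * q)"
    using assms by (simp add: field_simps)
  then have "1 + real q * (c / real (32 * q)) \<le> (1 + c / real (32 * q)) ^ q"
    by (rule Bernoulli_inequality)
  then have "1 + c / 32 \<le> (1 + c / real (32 * q)) ^ q" using assms by simp
  then have "(1 + c / 32) ^ 32 \<le> ((1 + c / real (32 * q)) ^ q) ^ 32"
    using assms by (intro power_mono) auto
  then show ?thesis by (simp add: power_mult[symmetric] mult.commute)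
qed

text \<open>Here \<open>a\<close> and \<open>b\<close> are the relative sizes of the two sides. The
  density can rise only by a factor 1 + O(1/q), and the admissible \<open>c\<close> depends on
  \<open>a * b\<close> alone.\<close>

lemma dense_max_bound:
  fixes c :: real
  assumes M: "dense_max E P Q (32 * q)" and fin: "finite P" "finite Q" and q: "q \<ge> 1"
    and pos: "card P > 0" "card Q > 0" and sub: "P' \<subseteq> P" "Q' \<subseteq> Q" and c: "c \<ge> 0"
    and card: "real (card P') = a * real (card P)" "real (card Q') = b * real (card Q)"
    and ab: "a > 0" "b > 0" and le: "1 \<le> (1 + c / 32) ^ 32 * (a * b)"
  shows "real (card (E \<inter> P' \<times> Q')) \<le>
    (1 + c / real (32 * q)) * dens E P Q * (real (card P') * real (card Q'))"
proof (rule dense_maxD[OF M fin sub])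
  let ?y = "1 + c / real (32 * q)"
  have "real (card P') > 0" "real (card Q') > 0" unfolding card using pos ab by auto
  then show "P' \<noteq> {}" "Q' \<noteq> {}" by auto
  have "1 \<le> ?y ^ (32 * q) * (a * b)"
    using order_trans[OF le mult_right_mono[OF Bernoulli_32[OF q]]] c ab by simp
  then have "1 * (real (card P) * real (card Q)) \<le> ?y ^ (32 * q) * (a * b) * (real (card P) * real (card Q))"
    by (intro mult_right_mono) auto
  then show "real (card P) * real (card Q) \<le> ?y ^ (32 * q) * (real (card P') * real (card Q'))"
    unfolding card by (simp only: mult_ac mult_1)
qed (use q c in auto)

section \<open>Disjoint rectangles without edges\<close>

lemma edges_UN:
  assumes "finite R" "finite R'" "\<And>l. l \<in> R \<Longrightarrow> finite (Pb l)" "\<And>l. l \<in> R' \<Longrightarrow> finite (Qb l)"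
    and "\<And>l l'. l \<in> R \<Longrightarrow> l' \<in> R \<Longrightarrow> l \<noteq> l' \<Longrightarrow> Pb l \<inter> Pb l' = {}"
    and "\<And>l l'. l \<in> R' \<Longrightarrow> l' \<in> R' \<Longrightarrow> l \<noteq> l' \<Longrightarrow> Qb l \<inter> Qb l' = {}"
  shows "card (E \<inter> (\<Union>l\<in>R. Pb l) \<times> (\<Union>l\<in>R'. Qb l)) = (\<Sum>l\<in>R. \<Sum>l'\<in>R'. card (E \<inter> Pb l \<times> Qb l'))"
proof -
  have "E \<inter> (\<Union>l\<in>R. Pb l) \<times> (\<Union>l\<in>R'. Qb l) = (\<Union>z\<in>R \<times> R'. E \<inter> Pb (fst z) \<times> Qb (snd z))"
    by auto
  also have "card \<dots> = (\<Sum>z\<in>R \<times> R'. card (E \<inter> Pb (fst z) \<times> Qb (snd z)))"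
  proof (rule card_UN_disjoint)
    show "\<forall>z\<in>R \<times> R'. \<forall>z'\<in>R \<times> R'. z \<noteq> z' \<longrightarrow>
      (E \<inter> Pb (fst z) \<times> Qb (snd z)) \<inter> (E \<inter> Pb (fst z') \<times> Qb (snd z')) = {}"
    proof (intro ballI impI)
      fix z z' assume z: "z \<in> R \<times> R'" "z' \<in> R \<times> R'" "z \<noteq> z'"
      then have "Pb (fst z) \<inter> Pb (fst z') = {} \<or> Qb (snd z) \<inter> Qb (snd z') = {}"
        using assms(5)[of "fst z" "fst z'"] assms(6)[of "snd z" "snd z'"]
        by (metis mem_Times_iff prod_eqI)
      then show "(E \<inter> Pb (fst z) \<times> Qb (snd z)) \<inter> (E \<inter> Pb (fst z') \<times> Qb (snd z')) = {}"
        by auto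
    qed
  qed (use assms in auto)
  also have "\<dots> = (\<Sum>l\<in>R. \<Sum>l'\<in>R'. card (E \<inter> Pb l \<times> Qb l'))"
    by (simp add: sum.cartesian_product case_prod_beta)
  finally show ?thesis .
qed

definition blocks :: "('a \<times> 'b) set \<Rightarrow> 'a set \<Rightarrow> 'b set \<Rightarrow> nat \<Rightarrow> nat \<Rightarrow> nat \<Rightarrow>
    (nat \<Rightarrow> 'a set) \<Rightarrow> (nat \<Rightarrow> 'b set) \<Rightarrow> bool" where
  "blocks E P Q h g b Pb Qb \<longleftrightarrow>
     (\<forall>l<b. Pb l \<subseteq> P \<and> Qb l \<subseteq> Q \<and> card (Pb l) = h \<and> card (Qb l) = g \<and> E \<inter> Pb l \<times> Qb l = {}) \<and>
     (\<forall>l<b. \<forall>l'<b. l \<noteq> l' \<longrightarrow> Pb l \<inter> Pb l' = {} \<and> Qb l \<inter> Qb l' = {})"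

lemma card_UN_bounded: "finite B \<Longrightarrow> (\<And>l. l \<in> B \<Longrightarrow> card (f l) \<le> h) \<Longrightarrow> card (\<Union>l\<in>B. f l) \<le> card B * h"
  using card_UN_le[of B f] sum_bounded_above[of B "\<lambda>l. card (f l)" h] by simp

text \<open>Greedy choice: remove the blocks found so far and look for another empty rectangle in
  the remainder. If the search stops short of \<open>b\<close> blocks, at most \<open>b - 1\<close>
  were removed, which is the stated loss.\<close>

lemma blocks_or_bidense:
  assumes fin: "finite P" "finite Q"
  shows "(\<exists>Pb Qb. blocks E P Q h g b Pb Qb) \<or>
    (\<exists>P1\<subseteq>P. \<exists>Q1\<subseteq>Q. card (P - P1) \<le> (b - 1) * h \<and> card (Q - Q1) \<le> (b - 1) * g \<and>
       (\<forall>P'\<subseteq>P1. \<forall>Q'\<subseteq>Q1. card P' = h \<longrightarrow> card Q' = g \<longrightarrow> E \<inter> P' \<times> Q' \<noteq> {}))"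
proof (induction b)
  case 0
  then show ?case by (simp add: blocks_def)
next
  case (Suc b)
  from Suc.IH show ?case
  proof (elim disjE)
    assume "\<exists>Pb Qb. blocks E P Q h g b Pb Qb"
    then obtain Pb Qb where bl: "blocks E P Q h g b Pb Qb" by blast
    define P1 Q1 where "P1 = P - (\<Union>l<b. Pb l)" and "Q1 = Q - (\<Union>l<b. Qb l)"
    show ?case
    proof (cases "\<forall>P'\<subseteq>P1. \<forall>Q'\<subseteq>Q1. card P' = h \<longrightarrow> card Q' = g \<longrightarrow> E \<inter> P' \<times> Q' \<noteq> {}")
      case True
      have "card (P - P1) \<le> card (\<Union>l<b. Pb l)" "card (Q - Q1) \<le> card (\<Union>l<b. Qb l)"
        using finite_subset[OF _ fin(1)] finite_subset[OF _ fin(2)] bl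
        by (auto intro!: card_mono finite_UN_I simp: P1_def Q1_def blocks_def)
      moreover have "card (\<Union>l<b. Pb l) \<le> b * h" "card (\<Union>l<b. Qb l) \<le> b * g"
        using card_UN_bounded[of "{..<b}" Pb h] card_UN_bounded[of "{..<b}" Qb g] bl by (auto simp: blocks_def)
      ultimately have "card (P - P1) \<le> (Suc b - 1) * h" "card (Q - Q1) \<le> (Suc b - 1) * g" by auto
      moreover have "P1 \<subseteq> P" "Q1 \<subseteq> Q" by (auto simp: P1_def Q1_def)
      ultimately show ?thesis using True by blast
    next
      case False
      then obtain P' Q' where *: "P' \<subseteq> P1" "Q' \<subseteq> Q1" "card P' = h" "card Q' = g" "E \<inter> P' \<times> Q' = {}"
        by blast
      have dis: "P' \<inter> Pb l = {}" "Q' \<inter> Qb l = {}" if "l < b" for l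
        using * that by (auto simp: P1_def Q1_def)
      have "blocks E P Q h g (Suc b) (Pb(b := P')) (Qb(b := Q'))"
        using bl * dis unfolding blocks_def
        by (auto simp: less_Suc_eq P1_def Q1_def)
      then show ?thesis by blast
    qed
  next
    assume "\<exists>P1\<subseteq>P. \<exists>Q1\<subseteq>Q. card (P - P1) \<le> (b - 1) * h \<and> card (Q - Q1) \<le> (b - 1) * g \<and>
       (\<forall>P'\<subseteq>P1. \<forall>Q'\<subseteq>Q1. card P' = h \<longrightarrow> card Q' = g \<longrightarrow> E \<inter> P' \<times> Q' \<noteq> {})"
    moreover have "(b - 1) * k \<le> (Suc b - 1) * k" for k :: nat by simp
    ultimately show ?case by (meson order_trans)
  qed
qed

lemma bidense_if_no_blocks:
  assumes "finite P" "finite Q" "\<And>Pb Qb. \<not> blocks E P Q h g b Pb Qb"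
  obtains P1 Q1 where "P1 \<subseteq> P" "Q1 \<subseteq> Q" "card (P - P1) \<le> (b - 1) * h" "card (Q - Q1) \<le> (b - 1) * g"
    "\<forall>P'\<subseteq>P1. \<forall>Q'\<subseteq>Q1. card P' = h \<longrightarrow> card Q' = g \<longrightarrow> E \<inter> P' \<times> Q' \<noteq> {}"
  using blocks_or_bidense[OF assms(1,2), of E h g b] assms(3) by (elim disjE exE conjE) blast+

text \<open>
  A balanced cut of the \<open>2q\<close> blocks avoids the empty diagonal products and so gains a factor
  \<open>1 + 1/(2q)\<close> of density at the price of a constant factor in size. This beats \<open>dense_max\<close>
  with exponent \<open>32q\<close>.
\<close>

lemma no_many_blocks:
  assumes M: "dense_max E P Q (32 * q)" and fin: "finite P" "finite Q" and q: "q \<ge> 1"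
    and pos: "dens E P Q > 0"
    and h: "real (card P) \<le> 8 * real q * real h" "2 * real q * real h \<le> (27/100) * real (card P)"
    and g: "real (card Q) \<le> 8 * real q * real g" "2 * real q * real g \<le> (27/100) * real (card Q)"
    and bl: "blocks E P Q h g (2 * q) Pb Qb"
  shows False
proof -
  let ?B = "{..<2 * q}"
  let ?d = "dens E P Q"
  let ?w = "\<lambda>l l'. real (card (E \<inter> Pb l \<times> Qb l'))"
  define p where "p = real (card P)"
  define r where "r = real (card Q)"
  have p: "p > 0" and r: "r > 0" using pos unfolding p_def r_def dens_def
    by (simp_all add: zero_less_divide_iff zero_less_mult_iff)
  have sub: "Pb l \<subseteq> P" "Qb l \<subseteq> Q" "card (Pb l) = h" "card (Qb l) = g" "E \<inter> Pb l \<times> Qb l = {}"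
    if "l \<in> ?B" for l using bl that unfolding blocks_def by auto
  have dis: "Pb l \<inter> Pb l' = {}" "Qb l \<inter> Qb l' = {}" if "l \<in> ?B" "l' \<in> ?B" "l \<noteq> l'" for l l'
    using bl that unfolding blocks_def by auto
  have finb: "finite (Pb l)" "finite (Qb l)" if "l \<in> ?B" for l
    using sub[OF that] fin finite_subset by blast+
  have cardP: "card (\<Union>l\<in>R. Pb l) = card R * h" if "R \<subseteq> ?B" for R
    using that finb sub dis finite_subset[OF that] by (subst card_UN_disjoint) (auto simp: subset_iff)
  have cardQ: "card (\<Union>l\<in>R. Qb l) = card R * g" if "R \<subseteq> ?B" for R
    using that finb sub dis finite_subset[OF that] by (subst card_UN_disjoint) (auto simp: subset_iff)
  have eUN: "card (E \<inter> (\<Union>l\<in>R. Pb l) \<times> (\<Union>l\<in>R'. Qb l)) = (\<Sum>l\<in>R. \<Sum>l'\<in>R'. card (E \<inter> Pb l \<times> Qb l'))"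
    if "R \<subseteq> ?B" "R' \<subseteq> ?B" for R R'
    by (rule edges_UN) (use that finb dis finite_subset[OF that(1)] finite_subset[OF that(2)] in \<open>auto simp: subset_iff\<close>)
  define T S where "T = (\<Union>l\<in>?B. Pb l)" and "S = (\<Union>l\<in>?B. Qb l)"
  have TS: "T \<subseteq> P" "S \<subseteq> Q" using sub unfolding T_def S_def by blast+
  have finTS: "finite T" "finite S" using TS fin finite_subset by blast+
  \<comment> \<open>The fractions of the two sides covered by all blocks together, kept between 1/4
    and 27/100.\<close>
  define t s where "t = 2 * real q * real h / p" and "s = 2 * real q * real g / r"
  have t: "1/4 \<le> t" "t \<le> (27/100)" using h p by (auto simp: t_def p_def field_simps)
  have s: "1/4 \<le> s" "s \<le> (27/100)" using g r by (auto simp: s_def r_def field_simps)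
  have cT: "real (card T) = t * p" using cardP[of ?B] p by (simp add: T_def t_def)
  have cS: "real (card S) = s * r" using cardQ[of ?B] r by (simp add: S_def s_def)
  have cT': "real (card (P - T)) = (1 - t) * p"
    using cT finTS TS fin by (simp add: card_Diff_subset of_nat_diff card_mono p_def algebra_simps)
  have cS': "real (card (Q - S)) = (1 - s) * r"
    using cS finTS TS fin by (simp add: card_Diff_subset of_nat_diff card_mono r_def algebra_simps)
  \<comment> \<open>In this unit the excess permitted by \<open>dense_max\<close> is
    \<open>c * z\<close>, while the balanced cut gains 1/(2q), which is
    \<open>16 * z\<close>.\<close>
  define z where "z = 1 / real (32 * q)"
  have z: "z > 0" "1 / (2 * real q) = 16 * z" using q by (auto simp: z_def)
  have bound: "real (card (E \<inter> P' \<times> Q')) \<le> (1 + c * z) * ?d * (real (card P') * real (card Q'))"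
    if "P' \<subseteq> P" "Q' \<subseteq> Q" "c \<ge> 0" "real (card P') = a * p" "real (card Q') = b * r" "a > 0" "b > 0"
       "1 \<le> (1 + c / 32) ^ 32 * (a * b)" for P' Q' a b c
    using dense_max_bound[OF M fin q _ _ that(1-3) that(4,5)[unfolded p_def r_def] that(6-8)] p r
    by (simp add: z_def p_def r_def)
  have "\<exists>R\<subseteq>?B. card R = q \<and>
    real q * (\<Sum>l\<in>?B. \<Sum>l'\<in>?B. ?w l l') \<le> real (2 * (2 * q - 1)) * (\<Sum>l\<in>R. \<Sum>l'\<in>?B - R. ?w l l')"
    by (rule balanced_cut) (use q sub in auto)
  then obtain R where R: "R \<subseteq> ?B" "card R = q" and
    cut: "real q * (\<Sum>l\<in>?B. \<Sum>l'\<in>?B. ?w l l') \<le> real (2 * (2 * q - 1)) * (\<Sum>l\<in>R. \<Sum>l'\<in>?B - R. ?w l l')"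
    by blast
  have cR: "card (?B - R) = q" using R by (simp add: card_Diff_subset finite_subset[OF R(1)])
  define PR QR where "PR = (\<Union>l\<in>R. Pb l)" and "QR = (\<Union>l\<in>?B - R. Qb l)"
  have cPR: "real (card PR) = t / 2 * p" and cQR: "real (card QR) = s / 2 * r"
    using cardP[OF R(1)] cardQ[of "?B - R"] cR R(2) p r by (simp_all add: PR_def QR_def t_def s_def)
  have "real (card (E \<inter> T \<times> S)) = (\<Sum>l\<in>?B. \<Sum>l'\<in>?B. ?w l l')"
    using eUN[of ?B ?B] by (simp add: T_def S_def)
  moreover have "real (card (E \<inter> PR \<times> QR)) = (\<Sum>l\<in>R. \<Sum>l'\<in>?B - R. ?w l l')"
    using eUN[of R "?B - R"] R(1) by (simp add: PR_def QR_def)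
  ultimately have "real q * real (card (E \<inter> T \<times> S)) \<le> real (2 * (2 * q - 1)) * real (card (E \<inter> PR \<times> QR))"
    using cut by simp
  also have "real (2 * (2 * q - 1)) = real q * (4 * (1 - 16 * z))"
    unfolding z(2)[symmetric] using q by (simp add: of_nat_diff field_simps)
  finally have TS1: "real (card (E \<inter> T \<times> S)) \<le> 4 * (1 - 16 * z) * real (card (E \<inter> PR \<times> QR))"
    using q by (simp add: mult.assoc)
  have z16: "16 * z \<le> 1" unfolding z(2)[symmetric] using q by simp
  have st: "1/16 \<le> t * s" using mult_mono[OF t(1) s(1)] t by simp
  \<comment> \<open>Half of the blocks on each side leave a relative size of at least 1/64, for
    which 9/2 is admissible. The net saving on the covered rectangle is 16 - 9/2 = 23/2, the
    negative term in \<open>z\<close> squared being dropped.\<close>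
  have "real (card (E \<inter> PR \<times> QR)) \<le> (1 + (9/2) * z) * ?d * (real (card PR) * real (card QR))"
  proof (rule bound[OF _ _ _ cPR cQR])
    show "PR \<subseteq> P" "QR \<subseteq> Q" using R sub unfolding PR_def QR_def by (auto simp: subset_iff)
    have "(64::real) \<le> (1 + (9/2) / 32) ^ 32" by (simp add: power_divide)
    then have "64 * (1/64) \<le> (1 + (9/2) / 32) ^ 32 * (t / 2 * (s / 2))" using st by (intro mult_mono) auto
    then show "1 \<le> (1 + (9/2) / 32) ^ 32 * (t / 2 * (s / 2))" by simp
  qed (use t s in auto)
  then have "4 * (1 - 16 * z) * real (card (E \<inter> PR \<times> QR)) \<le>
     4 * (1 - 16 * z) * ((1 + (9/2) * z) * ?d * (real (card PR) * real (card QR)))"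
    using z16 by (intro mult_left_mono) auto
  with TS1 have "real (card (E \<inter> T \<times> S)) \<le> 4 * (1 - 16 * z) * ((1 + (9/2) * z) * ?d * (real (card PR) * real (card QR)))"
    by linarith
  also have "\<dots> = ((1 - 16 * z) * (1 + (9/2) * z)) * (?d * p * r * (t * s))"
    unfolding cPR cQR by (simp add: field_simps)
  also have "\<dots> \<le> (1 - (23/2) * z) * (?d * p * r * (t * s))"
    using z p r t s by (intro mult_right_mono) (auto simp: algebra_simps)
  finally have e1: "real (card (E \<inter> T \<times> S)) \<le> (1 - (23/2) * z) * (?d * p * r * (t * s))" .
  \<comment> \<open>The uncovered part consists of two rectangles of relative size at least 1/4
    times 73/100 and 73/100; the admissible constants are 89/50 and 9/25.\<close>
  have "real (card (E \<inter> T \<times> (Q - S))) \<le> (1 + (89/50) * z) * ?d * (real (card T) * real (card (Q - S)))"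
  proof (rule bound[OF _ _ _ cT cS'])
    have "(11/2::real) \<le> (1 + (89/50) / 32) ^ 32" by (simp add: power_divide)
    moreover have "1/4 * (73/100) \<le> t * (1 - s)" using t s by (intro mult_mono) auto
    ultimately have "(11/2) * (1/4 * (73/100)) \<le> (1 + (89/50) / 32) ^ 32 * (t * (1 - s))"
      by (rule mult_mono) auto
    then show "1 \<le> (1 + (89/50) / 32) ^ 32 * (t * (1 - s))" by simp
  qed (use t s TS in auto)
  then have e2: "real (card (E \<inter> T \<times> (Q - S))) \<le> (1 + (89/50) * z) * (?d * p * r * (t * (1 - s)))"
    unfolding cT cS' by (simp add: mult_ac)
  have "real (card (E \<inter> (P - T) \<times> Q)) \<le> (1 + (9/25) * z) * ?d * (real (card (P - T)) * real (card Q))"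
  proof (rule bound[OF _ _ _ cT'])
    have "((7/5)::real) \<le> (1 + (9/25) / 32) ^ 32" by (simp add: power_divide)
    then have "(7/5) * (73/100) \<le> (1 + (9/25) / 32) ^ 32 * ((1 - t) * 1)" using t by (intro mult_mono) auto
    then show "1 \<le> (1 + (9/25) / 32) ^ 32 * ((1 - t) * 1)" by simp
  qed (use t s TS in \<open>auto simp: r_def\<close>)
  then have e3: "real (card (E \<inter> (P - T) \<times> Q)) \<le> (1 + (9/25) * z) * (?d * p * r * (1 - t))"
    unfolding cT' r_def[symmetric] by (simp add: mult_ac)
  have "E \<inter> P \<times> Q = (E \<inter> T \<times> S) \<union> (E \<inter> T \<times> (Q - S)) \<union> (E \<inter> (P - T) \<times> Q)"
    using TS by auto
  then have "card (E \<inter> P \<times> Q) \<le> card (E \<inter> T \<times> S) + card (E \<inter> T \<times> (Q - S)) + card (E \<inter> (P - T) \<times> Q)"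
    by (metis card_Un_le add_le_mono1 order_trans)
  then have "real (card (E \<inter> P \<times> Q)) \<le> real (card (E \<inter> T \<times> S)) + real (card (E \<inter> T \<times> (Q - S))) + real (card (E \<inter> (P - T) \<times> Q))"
    by linarith
  moreover have "real (card (E \<inter> P \<times> Q)) = ?d * p * r"
    using edges_eq_dens[OF fin, of E] p r by (simp add: p_def r_def) 
  ultimately have "?d * p * r * 1 \<le> ?d * p * r * ((1 - (23/2) * z) * (t * s) + (1 + (89/50) * z) * (t * (1 - s)) + (1 + (9/25) * z) * (1 - t))"
  proof -
    have "?d * p * r * ((1 - (23/2) * z) * (t * s) + (1 + (89/50) * z) * (t * (1 - s)) + (1 + (9/25) * z) * (1 - t))
      = (1 - (23/2) * z) * (?d * p * r * (t * s)) + (1 + (89/50) * z) * (?d * p * r * (t * (1 - s))) +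
        (1 + (9/25) * z) * (?d * p * r * (1 - t))" by (simp only: distrib_left mult_ac)
    with \<open>real (card (E \<inter> P \<times> Q)) \<le> _\<close> \<open>real (card (E \<inter> P \<times> Q)) = _\<close> e1 e2 e3
    show ?thesis by linarith
  qed
  \<comment> \<open>The terms of order 0 add up to 1, so the coefficient of \<open>z\<close> must be
    nonnegative. With \<open>s\<close> at least 1/4 this forces \<open>t\<close> below 1/4, a
    contradiction.\<close>
  then have "1 \<le> (1 - (23/2) * z) * (t * s) + (1 + (89/50) * z) * (t * (1 - s)) + (1 + (9/25) * z) * (1 - t)"
    using pos p r by (simp only: mult_le_cancel_left_pos mult_pos_pos)
  also have "\<dots> = 1 + z * ((71/50) * t + (9/25) - (332/25) * (t * s))"
    by (simp add: field_simps)
  finally have "0 \<le> z * ((71/50) * t + (9/25) - (332/25) * (t * s))" by simp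
  then have "(332/25) * (t * s) \<le> (71/50) * t + (9/25)" using z by (simp add: zero_le_mult_iff)
  moreover have "t * (1/4) \<le> t * s" using t s by (intro mult_left_mono) auto
  ultimately show False using t by linarith
qed

text \<open>The two strips outside \<open>P' \<times> Q'\<close> are at most slightly denser than
  average, so the remaining quarter keeps a fraction 1 - (17/5) / (32q) of the density. The power
  32q of this fraction costs less than 2^6, and the sizes cost at most 2^2. The upper limits 51/100
  keep the strips large enough for \<open>dense_max_bound\<close>.\<close>

lemma half_density:
  assumes M: "dense_max E P Q (32 * q)" and fin: "finite P" "finite Q" and q: "q \<ge> 1"
    and pos: "dens E P Q > 0" and sub: "P' \<subseteq> P" "Q' \<subseteq> Q"
    and x: "real (card P) / 2 \<le> real (card P')" "real (card P') \<le> (51/100) * real (card P)"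
    and w: "real (card Q) / 2 \<le> real (card Q')" "real (card Q') \<le> (51/100) * real (card Q)"
  shows "real (card P) * real (card Q) * dens E P Q ^ (32 * q)
    < 2 ^ 8 * (real (card P') * real (card Q') * dens E P' Q' ^ (32 * q))"
proof -
  let ?d = "dens E P Q"
  define p r where "p = real (card P)" and "r = real (card Q)"
  have p: "p > 0" and r: "r > 0" using pos unfolding p_def r_def dens_def
    by (simp_all add: zero_less_divide_iff zero_less_mult_iff)
  define x w z where "x = real (card P') / p" and "w = real (card Q') / r" and "z = 1 / real (32 * q)"
  have z: "z > 0" "z \<le> 1 / 32" using q by (auto simp: z_def field_simps)
  have x: "1/2 \<le> x" "x \<le> (51/100)" using x p by (auto simp: x_def p_def field_simps)
  have w: "1/2 \<le> w" "w \<le> (51/100)" using w r by (auto simp: w_def r_def field_simps)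
  have fin': "finite P'" "finite Q'" using fin sub finite_subset by blast+
  have cP: "real (card P') = x * p" and cQ: "real (card Q') = w * r"
    using p r by (simp_all add: x_def w_def)
  have cP': "real (card (P - P')) = (1 - x) * p"
    using cP fin' sub fin by (simp add: card_Diff_subset of_nat_diff card_mono p_def algebra_simps)
  have cQ': "real (card (Q - Q')) = (1 - w) * r"
    using cQ fin' sub fin by (simp add: card_Diff_subset of_nat_diff card_mono r_def algebra_simps)
  have bound: "real (card (E \<inter> A \<times> B)) \<le> (1 + c * z) * ?d * (real (card A) * real (card B))"
    if "A \<subseteq> P" "B \<subseteq> Q" "c \<ge> 0" "real (card A) = a * p" "real (card B) = b * r" "a > 0" "b > 0"
       "1 \<le> (1 + c / 32) ^ 32 * (a * b)" for A B a b c
    using dense_max_bound[OF M fin q _ _ that(1-3) that(4,5)[unfolded p_def r_def] that(6-8)] p r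
    by (simp add: z_def p_def r_def)
  \<comment> \<open>The strips have relative size at least 49/100 and half of that; 22/25 and 79/50
    are admissible for these sizes.\<close>
  have "real (card (E \<inter> (P - P') \<times> Q)) \<le> (1 + (22/25) * z) * ?d * (real (card (P - P')) * real (card Q))"
  proof (rule bound[OF _ _ _ cP'])
    have "((21/10)::real) \<le> (1 + (22/25) / 32) ^ 32" by (simp add: power_divide)
    then have "(21/10) * (49/100) \<le> (1 + (22/25) / 32) ^ 32 * ((1 - x) * 1)" using x by (intro mult_mono) auto
    then show "1 \<le> (1 + (22/25) / 32) ^ 32 * ((1 - x) * 1)" by simp
  qed (use x in \<open>auto simp: r_def\<close>)
  then have e1: "real (card (E \<inter> (P - P') \<times> Q)) \<le> (1 + (22/25) * z) * (?d * p * r * (1 - x))"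
    unfolding cP' r_def[symmetric] by (simp add: mult_ac)
  have "real (card (E \<inter> P' \<times> (Q - Q'))) \<le> (1 + (79/50) * z) * ?d * (real (card P') * real (card (Q - Q')))"
  proof (rule bound[OF _ _ _ cP cQ'])
    have "((21/5)::real) \<le> (1 + (79/50) / 32) ^ 32" by (simp add: power_divide)
    moreover have "1/2 * (49/100) \<le> x * (1 - w)" using x w by (intro mult_mono) auto
    ultimately have "(21/5) * (1/2 * (49/100)) \<le> (1 + (79/50) / 32) ^ 32 * (x * (1 - w))"
      by (rule mult_mono) auto
    then show "1 \<le> (1 + (79/50) / 32) ^ 32 * (x * (1 - w))" by simp
  qed (use x w sub in auto)
  then have e2: "real (card (E \<inter> P' \<times> (Q - Q'))) \<le> (1 + (79/50) * z) * (?d * p * r * (x * (1 - w)))"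
    unfolding cP cQ' by (simp add: mult_ac)
  have "E \<inter> P \<times> Q = (E \<inter> P' \<times> Q') \<union> (E \<inter> P' \<times> (Q - Q')) \<union> (E \<inter> (P - P') \<times> Q)"
    using sub by auto
  then have "card (E \<inter> P \<times> Q) \<le> card (E \<inter> P' \<times> Q') + card (E \<inter> P' \<times> (Q - Q')) + card (E \<inter> (P - P') \<times> Q)"
    by (metis card_Un_le add_le_mono1 order_trans)
  then have "real (card (E \<inter> P \<times> Q)) \<le> real (card (E \<inter> P' \<times> Q')) + real (card (E \<inter> P' \<times> (Q - Q'))) + real (card (E \<inter> (P - P') \<times> Q))"
    by linarith
  moreover have "real (card (E \<inter> P \<times> Q)) = ?d * p * r"
    using edges_eq_dens[OF fin, of E] p r by (simp add: p_def r_def)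
  ultimately have "?d * p * r * (x * w - z * ((22/25) * (1 - x) + (79/50) * (x * (1 - w)))) \<le> real (card (E \<inter> P' \<times> Q'))"
  proof -
    have lin: "D * (1 - a * b - e * f) = D - a * (D * b) - e * (D * f)" for a b e f D :: real
      by (simp add: algebra_simps)
    have "x * w - z * ((22/25) * (1 - x) + (79/50) * (x * (1 - w))) =
      1 - (1 + (22/25) * z) * (1 - x) - (1 + (79/50) * z) * (x * (1 - w))" by (simp add: algebra_simps)
    then have "?d * p * r * (x * w - z * ((22/25) * (1 - x) + (79/50) * (x * (1 - w)))) =
      ?d * p * r - (1 + (22/25) * z) * (?d * p * r * (1 - x)) - (1 + (79/50) * z) * (?d * p * r * (x * (1 - w)))"
      using lin[of "?d * p * r"] by simp
    moreover have "g \<le> u3" if "u \<le> u3 + u2 + u1" "u = D" "u1 \<le> a" "u2 \<le> b" "g = D - a - b"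
      for g u u1 u2 u3 D a b :: real using that by linarith
    ultimately show ?thesis
      using \<open>real (card (E \<inter> P \<times> Q)) \<le> _\<close> \<open>real (card (E \<inter> P \<times> Q)) = _\<close> e1 e2 by blast
  qed
  \<comment> \<open>The excess in the strips is at most 0.44 + 0.41 = (17/5) / 4, and
    \<open>x * w\<close> is at least 1/4.\<close>
  moreover have "(1 - (17/5) * z) * (x * w) \<le> x * w - z * ((22/25) * (1 - x) + (79/50) * (x * (1 - w)))"
  proof -
    have "x * (1 - w) \<le> (51/100) * (1/2)" using x w by (intro mult_mono) auto
    moreover have "1/2 * (1/2) \<le> x * w" using x w by (intro mult_mono) auto
    moreover have "(22/25) * (1 - x) + (79/50) * y \<le> (17/5) * v"
      if "y \<le> (51/100) * (1/2)" "1/2 * (1/2) \<le> v" for y v :: real using that x by (simp add: field_simps)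
    ultimately have "(22/25) * (1 - x) + (79/50) * (x * (1 - w)) \<le> (17/5) * (x * w)" by blast
    then have "z * ((22/25) * (1 - x) + (79/50) * (x * (1 - w))) \<le> z * ((17/5) * (x * w))"
      using z by (intro mult_left_mono) auto
    then show ?thesis by (simp add: algebra_simps)
  qed
  then have "?d * p * r * ((1 - (17/5) * z) * (x * w)) \<le> ?d * p * r * (x * w - z * ((22/25) * (1 - x) + (79/50) * (x * (1 - w))))"
    using pos p r by (intro mult_left_mono) auto
  ultimately have "(?d * (1 - (17/5) * z)) * (x * p * (w * r)) \<le> real (card (E \<inter> P' \<times> Q'))"
    by (simp add: mult_ac)
  then have d': "?d * (1 - (17/5) * z) \<le> dens E P' Q'"
    unfolding dens_def[of E P'] cP cQ using p r x w by (subst pos_le_divide_eq) auto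
  have "(1 + (-(17/5)) / 32 :: real) ^ 32 \<le> (1 + (-(17/5)) / real (32 * q)) ^ (32 * q)"
    by (rule Bernoulli_32[OF q]) simp
  moreover have "1 < (2::real) ^ 6 * (1 + (-(17/5)) / 32) ^ 32" by (simp add: power_divide)
  ultimately have N: "1 < 2 ^ 6 * (1 - (17/5) * z) ^ (32 * q)" by (simp add: z_def)
  have "p * r * ?d ^ (32 * q) * 1 < p * r * ?d ^ (32 * q) * (2 ^ 6 * (1 - (17/5) * z) ^ (32 * q))"
    using N p r pos by (intro mult_strict_left_mono) auto
  also have "\<dots> = 2 ^ 8 * ((1/2 * p) * (1/2 * r) * (?d * (1 - (17/5) * z)) ^ (32 * q))"
    by (simp add: power_mult_distrib)
  also have "\<dots> \<le> 2 ^ 8 * ((x * p) * (w * r) * dens E P' Q' ^ (32 * q))"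
    using x w p r d' pos z by (intro mult_left_mono mult_mono power_mono) auto
  finally show ?thesis unfolding cP cQ p_def[symmetric] r_def[symmetric] by simp
qed

section \<open>Colourings in which any two colours are 3-colourable\<close>

definition colours :: "('a \<Rightarrow> 'a \<Rightarrow> nat) \<Rightarrow> 'a set \<Rightarrow> nat set" where
  "colours c X = {c u v | u v. u \<in> X \<and> v \<in> X \<and> u \<noteq> v}"

text \<open>The case \<open>i = k\<close> covers a single colour. A colour that does not occur
  imposes no condition, so \<open>i\<close> and \<open>k\<close> may range over all natural
  numbers.\<close>

definition pairs_3col :: "('a \<Rightarrow> 'a \<Rightarrow> nat) \<Rightarrow> 'a set \<Rightarrow> bool" where
  "pairs_3col c X \<longleftrightarrow> (\<forall>i k. \<exists>f::'a \<Rightarrow> nat. (\<forall>v\<in>X. f v < 3) \<and>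
     (\<forall>u\<in>X. \<forall>v\<in>X. u \<noteq> v \<longrightarrow> c u v \<in> {i, k} \<longrightarrow> f u \<noteq> f v))"

lemma colours_mono: "X \<subseteq> Y \<Longrightarrow> colours c X \<subseteq> colours c Y"
  unfolding colours_def by blast

lemma finite_colours [simp]: "finite X \<Longrightarrow> finite (colours c X)"
  by (rule finite_subset[of _ "(\<lambda>(u, v). c u v) ` (X \<times> X)"]) (auto simp: colours_def)

lemma pairs_3col_subset:
  assumes "pairs_3col c X" "Y \<subseteq> X"
  shows "pairs_3col c Y"
  unfolding pairs_3col_def
proof (intro allI)
  fix i k
  obtain f :: "'a \<Rightarrow> nat" where "\<forall>v\<in>X. f v < 3"
    "\<forall>u\<in>X. \<forall>v\<in>X. u \<noteq> v \<longrightarrow> c u v \<in> {i, k} \<longrightarrow> f u \<noteq> f v"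
    using assms(1)[unfolded pairs_3col_def, rule_format, of i k] by blast
  then show "\<exists>f::'a \<Rightarrow> nat. (\<forall>v\<in>Y. f v < 3) \<and>
      (\<forall>u\<in>Y. \<forall>v\<in>Y. u \<noteq> v \<longrightarrow> c u v \<in> {i, k} \<longrightarrow> f u \<noteq> f v)"
    using assms(2) by (intro exI[of _ f]) blast
qed

text \<open>In a 3-colouring of the union of \<open>i\<close> and \<open>k\<close>, a class large on
  both sides would contain an edge of colour \<open>i\<close>. So each class is small on
  \<open>P\<close> or on \<open>Q\<close>, and two of the three are small on the same side. Deleting
  these leaves one class there, which spans no edge of colour \<open>k\<close>; the other side is
  left untouched.\<close>

lemma bidense_kills_colour:
  assumes fin: "finite P" "finite Q" and sub: "P \<subseteq> X" "Q \<subseteq> X" and col: "pairs_3col c X"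
    and bidense: "\<forall>P'\<subseteq>P. \<forall>Q'\<subseteq>Q. card P' = h \<longrightarrow> card Q' = g \<longrightarrow>
      {(u, v). u \<noteq> v \<and> c u v = i} \<inter> P' \<times> Q' \<noteq> {}"
  shows "\<exists>S T. finite S \<and> finite T \<and> card S \<le> 2 * (h - 1) \<and> card T \<le> 2 * (g - 1) \<and>
    k \<notin> colours c (P - S) \<inter> colours c (Q - T)"
proof -
  obtain f :: "'a \<Rightarrow> nat" where f3: "\<And>v. v \<in> X \<Longrightarrow> f v < 3"
    and f: "\<And>u v. u \<in> X \<Longrightarrow> v \<in> X \<Longrightarrow> u \<noteq> v \<Longrightarrow> c u v \<in> {i, k} \<Longrightarrow> f u \<noteq> f v"
    using col[unfolded pairs_3col_def, rule_format, of i k] by blast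
  define A where "A j = {v \<in> P. f v = j}" for j
  define B where "B j = {v \<in> Q. f v = j}" for j
  have small: "card (A j) < h \<or> card (B j) < g" for j
  proof (rule ccontr)
    assume "\<not> ?thesis"
    then have "h \<le> card (A j)" "g \<le> card (B j)" by simp_all
    obtain P' where P': "P' \<subseteq> A j" "card P' = h"
      using obtain_subset_with_card_n[OF \<open>h \<le> card (A j)\<close>] by blast
    obtain Q' where Q': "Q' \<subseteq> B j" "card Q' = g"
      using obtain_subset_with_card_n[OF \<open>g \<le> card (B j)\<close>] by blast
    note PQ = P' Q'
    have "P' \<subseteq> P" "Q' \<subseteq> Q" using PQ by (auto simp: A_def B_def)
    then have "{(u, v). u \<noteq> v \<and> c u v = i} \<inter> P' \<times> Q' \<noteq> {}"
      using bidense PQ by blast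
    then obtain u v where "u \<in> P'" "v \<in> Q'" "u \<noteq> v" "c u v = i" by auto
    moreover from this have "u \<in> X" "v \<in> X" "f u = f v" using PQ sub by (auto simp: A_def B_def)
    ultimately show False using f[of u v] by simp
  qed
  \<comment> \<open>An edge of colour \<open>k\<close> that avoids both classes would need two
    further values of \<open>f\<close> below 3.\<close>
  have kill: "k \<notin> colours c (R - ({v \<in> R. f v = j} \<union> {v \<in> R. f v = j'}))"
    if "R \<subseteq> X" "j < 3" "j' < 3" "j \<noteq> j'" for R j j'
  proof
    assume "k \<in> colours c (R - ({v \<in> R. f v = j} \<union> {v \<in> R. f v = j'}))"
    then obtain u v where uv: "u \<in> R" "v \<in> R" "u \<noteq> v" "c u v = k" "f u \<noteq> j" "f u \<noteq> j'" "f v \<noteq> j" "f v \<noteq> j'"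
      unfolding colours_def by auto
    then have "u \<in> X" "v \<in> X" using that by auto
    then have *: "f u < 3" "f v < 3" "f u \<noteq> f v" using f3 f[of u v] uv by auto
    have "card {f u, f v, j, j'} \<le> card {..<3::nat}" using * that by (intro card_mono) auto
    moreover have "card {f u, f v, j, j'} = 4" using * uv that by simp
    ultimately show False by simp
  qed
  have *: "(\<exists>j j'. j < 3 \<and> j' < 3 \<and> j \<noteq> j' \<and> card (A j) < h \<and> card (A j') < h) \<or>
        (\<exists>j j'. j < 3 \<and> j' < 3 \<and> j \<noteq> j' \<and> card (B j) < g \<and> card (B j') < g)"
  proof (rule ccontr)
    assume n: "\<not> ?thesis"
    have a: "\<not> (card (A j) < h \<and> card (A j') < h)" and b: "\<not> (card (B j) < g \<and> card (B j') < g)"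
      if "j < 3" "j' < 3" "j \<noteq> j'" for j j'
      using n that by metis+
    have "\<not> (card (A 0) < h \<and> card (A 1) < h)" "\<not> (card (A 0) < h \<and> card (A 2) < h)"
      "\<not> (card (A 1) < h \<and> card (A 2) < h)" "\<not> (card (B 0) < g \<and> card (B 1) < g)"
      "\<not> (card (B 0) < g \<and> card (B 2) < g)" "\<not> (card (B 1) < g \<and> card (B 2) < g)"
      using a[of 0 1] a[of 0 2] a[of 1 2] b[of 0 1] b[of 0 2] b[of 1 2] by simp_all
    then show False using small[of 0] small[of 1] small[of 2] by blast
  qed
  from * show ?thesis
  proof (elim disjE exE conjE)
    fix j j' :: nat assume j: "j < 3" "j' < 3" "j \<noteq> j'" "card (A j) < h" "card (A j') < h"
    have "card (A j \<union> A j') \<le> 2 * (h - 1)" using card_Un_le[of "A j" "A j'"] j by linarith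
    moreover have "k \<notin> colours c (P - (A j \<union> A j'))" using kill[OF sub(1)] j by (simp add: A_def)
    moreover have "finite (A j \<union> A j')" using fin by (simp add: A_def)
    ultimately show ?thesis by (intro exI[of _ "A j \<union> A j'"] exI[of _ "{}"]) auto
  next
    fix j j' :: nat assume j: "j < 3" "j' < 3" "j \<noteq> j'" "card (B j) < g" "card (B j') < g"
    have "card (B j \<union> B j') \<le> 2 * (g - 1)" using card_Un_le[of "B j" "B j'"] j by linarith
    moreover have "k \<notin> colours c (Q - (B j \<union> B j'))" using kill[OF sub(2)] j by (simp add: B_def)
    moreover have "finite (B j \<union> B j')" using fin by (simp add: B_def)
    ultimately show ?thesis by (intro exI[of _ "B j \<union> B j'"] exI[of _ "{}"]) auto
  qed
qed

text \<open>Pigeonhole over the colours. Ordered pairs of distinct points make up at least half of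
  \<open>X \<times> X\<close>, hence the factor 2.\<close>

lemma dense_colour:
  assumes fin: "finite X" and card: "card X \<ge> 2"
  shows "\<exists>i. 1 / (2 * real (card (colours c X))) \<le> dens {(u, v). u \<noteq> v \<and> c u v = i} X X"
proof (rule ccontr)
  let ?C = "colours c X" and ?m = "real (card X)"
  let ?E = "\<lambda>i. {(u, v). u \<noteq> v \<and> c u v = i}"
  assume "\<not> ?thesis"
  then have lt: "\<And>i. dens (?E i) X X < 1 / (2 * real (card ?C))" by (meson not_le)
  have ne: "?C \<noteq> {}"
  proof -
    obtain u v where "u \<in> X" "v \<in> X" "u \<noteq> v"
      using card card_le_Suc0_iff_eq[OF fin] by fastforce
    then show ?thesis unfolding colours_def by blast
  qed
  have m: "?m > 0" using card by simp
  have "{(u, v). u \<noteq> v} \<inter> X \<times> X = (\<Union>i\<in>?C. ?E i \<inter> X \<times> X)"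
    unfolding colours_def by auto
  also have "card \<dots> = (\<Sum>i\<in>?C. card (?E i \<inter> X \<times> X))"
    using fin by (intro card_UN_disjoint) auto
  finally have 1: "real (card ({(u, v). u \<noteq> v} \<inter> X \<times> X)) = (\<Sum>i\<in>?C. real (card (?E i \<inter> X \<times> X)))"
    by simp
  also have "\<dots> < (\<Sum>i\<in>?C. ?m\<^sup>2 / (2 * real (card ?C)))"
  proof (rule sum_strict_mono)
    fix i
    have "real (card (?E i \<inter> X \<times> X)) = dens (?E i) X X * (?m * ?m)"
      using edges_eq_dens[of X X "?E i"] fin m by auto
    also have "\<dots> < 1 / (2 * real (card ?C)) * (?m * ?m)"
      using lt[of i] m by (intro mult_strict_right_mono) auto
    finally show "real (card (?E i \<inter> X \<times> X)) < ?m\<^sup>2 / (2 * real (card ?C))"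
      by (simp add: power2_eq_square)
  qed (use ne fin in auto)
  also have "\<dots> = ?m\<^sup>2 / 2" using ne fin by (simp add: card_gt_0_iff)
  finally have "real (card ({(u, v). u \<noteq> v} \<inter> X \<times> X)) < ?m\<^sup>2 / 2" .
  moreover have "card (X \<times> X) \<le> card ({(u, v). u \<noteq> v} \<inter> X \<times> X) + card ((\<lambda>u. (u, u)) ` X)"
    by (rule order_trans[OF card_mono card_Un_le]) (use fin in auto)
  then have "card X * card X \<le> card ({(u, v). u \<noteq> v} \<inter> X \<times> X) + card X"
    using card_image_le[OF fin, of "\<lambda>u. (u, u)"] by (simp add: card_cartesian_product)
  then have "?m\<^sup>2 \<le> real (card ({(u, v). u \<noteq> v} \<inter> X \<times> X)) + ?m"
    unfolding power2_eq_square by (metis of_nat_add of_nat_le_iff of_nat_mult)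
  moreover have "?m * 2 \<le> ?m\<^sup>2" unfolding power2_eq_square using card by (intro mult_left_mono) auto
  ultimately show False by linarith
qed

text \<open>A crude bound for few colours: a 3-colouring of one colour splits \<open>X\<close> into
  three parts that avoid this colour.\<close>

lemma card_le_3_power:
  assumes "finite X" "pairs_3col c X" "card (colours c X) \<le> n"
  shows "card X \<le> 3 ^ n"
  using assms
proof (induction n arbitrary: X)
  case 0
  then have "colours c X = {}" by simp
  then have "u = v" if "u \<in> X" "v \<in> X" for u v using that unfolding colours_def by blast
  then show ?case using 0 by (simp add: card_le_Suc0_iff_eq)
next
  case (Suc n)
  show ?case
  proof (cases "colours c X = {}")
    case True
    then have "card X \<le> 3 ^ n" using Suc by simp
    then show ?thesis by simp
  next
    case False
    then obtain i where i: "i \<in> colours c X" by blast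
    obtain f :: "'a \<Rightarrow> nat" where f3: "\<And>v. v \<in> X \<Longrightarrow> f v < 3"
      and f: "\<And>u v. u \<in> X \<Longrightarrow> v \<in> X \<Longrightarrow> u \<noteq> v \<Longrightarrow> c u v \<in> {i, i} \<Longrightarrow> f u \<noteq> f v"
      using Suc.prems(2)[unfolded pairs_3col_def, rule_format, of i i] by blast
    have le: "card {v \<in> X. f v = j} \<le> 3 ^ n" for j
    proof (rule Suc.IH)
      let ?Y = "{v \<in> X. f v = j}"
      show "finite ?Y" using Suc by simp
      show "pairs_3col c ?Y" using pairs_3col_subset[OF Suc.prems(2), of ?Y] by auto
      have "i \<notin> colours c ?Y" using f by (force simp: colours_def)
      then have "colours c ?Y \<subseteq> colours c X - {i}" using colours_mono[of ?Y X c] by auto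
      then show "card (colours c ?Y) \<le> n"
        using card_mono[of "colours c X - {i}" "colours c ?Y"] i Suc.prems by simp
    qed
    let ?U = "\<Union>j<3. {v \<in> X. f v = j}"
    have "card X \<le> card ?U" using f3 Suc.prems(1) by (intro card_mono) auto
    also have "card ?U \<le> card {..<3::nat} * 3 ^ n" by (rule card_UN_bounded) (use le in auto)
    finally have "card X \<le> card {..<3::nat} * 3 ^ n" .
    then show ?thesis by simp
  qed
qed

section \<open>Halving the number of colours\<close>

lemma ceiling_div:
  fixes a n :: nat
  assumes "n > 0"
  obtains h where "a \<le> n * h" "n * h < a + n"
proof
  let ?h = "(a + n - 1) div n"
  have "n * ?h + (a + n - 1) mod n = a + n - 1" by simp
  moreover have "(a + n - 1) mod n < n" using assms by simp
  ultimately show "a \<le> n * ?h" "n * ?h < a + n" using assms by linarith+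
qed

lemma max_on_finite:
  fixes f :: "'a \<Rightarrow> real"
  assumes "finite S" "S \<noteq> {}"
  shows "\<exists>x\<in>S. \<forall>y\<in>S. f y \<le> f x"
proof -
  have "Max (f ` S) \<in> f ` S" using assms by simp
  then obtain x where x: "x \<in> S" "f x = Max (f ` S)" by auto
  then show ?thesis using assms by (intro bexI[of _ x]) auto
qed

text \<open>Blocks of about 1/(8q) of a side are used: by \<open>no_many_blocks\<close> there are
  fewer than \<open>2 * q\<close> of them, so making the pair bidense costs at most a quarter of
  each side. Removing up to \<open>q\<close> colours with \<open>bidense_kills_colour\<close> costs
  at most another quarter.\<close>

lemma halve_sides:
  assumes fin: "finite P" "finite Q" and sub: "P \<subseteq> X" "Q \<subseteq> X" and col: "pairs_3col c X"
    and M: "dense_max {(u, v). u \<noteq> v \<and> c u v = i} P Q (32 * q)" and q: "q \<ge> 1"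
    and pos: "dens {(u, v). u \<noteq> v \<and> c u v = i} P Q > 0"
    and big: "card P \<ge> 200 * q\<^sup>2" "card Q \<ge> 200 * q\<^sup>2"
    and K: "K \<subseteq> colours c P \<inter> colours c Q" "card K \<le> q"
  shows "\<exists>P'\<subseteq>P. \<exists>Q'\<subseteq>Q. card P \<le> 2 * card P' \<and> card Q \<le> 2 * card Q' \<and>
    K \<inter> colours c P' \<inter> colours c Q' = {}"
proof -
  let ?E = "{(u, v). u \<noteq> v \<and> c u v = i}"
  \<comment> \<open>\<open>h\<close> is \<open>a\<close> / (8q) rounded up. The bound 200 q^2 makes
    the rounding harmless: 2qh is at most 26/100 of \<open>a\<close>, and \<open>h\<close> at least
    25q brings (2q - 1) h down to a quarter of \<open>a\<close>.\<close>
  have step: "\<exists>h. real a \<le> 8 * real q * real h \<and> 2 * real q * real h \<le> 27/100 * real a \<and>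
     real ((2 * q - 1) * h) \<le> real a / 4 \<and> real (q * (2 * (h - 1))) \<le> real a / 4"
    if big: "a \<ge> 200 * q\<^sup>2" for a
  proof -
    obtain h where h: "a \<le> (8 * q) * h" "(8 * q) * h < a + 8 * q"
      using ceiling_div[of "8 * q" a] q by auto
    have h': "real a \<le> 8 * (real q * real h)" "8 * (real q * real h) < real a + 8 * real q"
      using h by (metis mult.assoc of_nat_le_iff of_nat_mult of_nat_numeral)
        (metis h(2) mult.assoc of_nat_less_iff of_nat_mult of_nat_numeral of_nat_add)
    have a: "real a \<ge> 200 * (real q * real q)"
      using big by (metis of_nat_le_iff of_nat_mult of_nat_numeral power2_eq_square)
    have qq: "real q \<le> real q * real q" using q by simp
    have "real q * (25 * real q) \<le> real q * real h" using a h'(1) by simp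
    then have hq: "25 * real q \<le> real h" using q by simp
    then have h1: "h \<ge> 1" using q by (cases h) auto
    have "2 * (real q * real h) \<le> 27/100 * real a" using h' a qq by linarith
    moreover have "real ((2 * q - 1) * h) = 2 * (real q * real h) - real h"
      using q by (simp add: of_nat_diff algebra_simps)
    moreover have "2 * (real q * real h) - real h \<le> real a / 4" using h' hq q by linarith
    moreover have "real (q * (2 * (h - 1))) = 2 * (real q * real h) - 2 * real q"
      using h1 by (cases h) (simp_all add: algebra_simps)
    moreover have "2 * (real q * real h) - 2 * real q \<le> real a / 4" using h' by linarith
    ultimately have "real a \<le> 8 * real q * real h" "2 * real q * real h \<le> 27/100 * real a"
      "real ((2 * q - 1) * h) \<le> real a / 4" "real (q * (2 * (h - 1))) \<le> real a / 4"
      using h'(1) by (simp_all only: mult.assoc)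
    then show ?thesis by blast
  qed
  obtain h where h: "real (card P) \<le> 8 * real q * real h" "2 * real q * real h \<le> 27/100 * real (card P)"
     "real ((2 * q - 1) * h) \<le> real (card P) / 4" "real (q * (2 * (h - 1))) \<le> real (card P) / 4"
    using step[OF big(1)] by blast
  obtain g where g: "real (card Q) \<le> 8 * real q * real g" "2 * real q * real g \<le> 27/100 * real (card Q)"
     "real ((2 * q - 1) * g) \<le> real (card Q) / 4" "real (q * (2 * (g - 1))) \<le> real (card Q) / 4"
    using step[OF big(2)] by blast
  obtain P1 Q1 where P1: "P1 \<subseteq> P" "Q1 \<subseteq> Q" "card (P - P1) \<le> (2 * q - 1) * h" "card (Q - Q1) \<le> (2 * q - 1) * g"
    "\<forall>P'\<subseteq>P1. \<forall>Q'\<subseteq>Q1. card P' = h \<longrightarrow> card Q' = g \<longrightarrow> ?E \<inter> P' \<times> Q' \<noteq> {}"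
    using bidense_if_no_blocks[OF fin no_many_blocks[OF M fin q pos h(1,2) g(1,2), THEN notI]] .
  have fin1: "finite P1" "finite Q1" using P1 fin finite_subset by blast+
  have P1X: "P1 \<subseteq> X" "Q1 \<subseteq> X" using P1 sub by auto
  have "\<forall>k. \<exists>S T. finite S \<and> finite T \<and> card S \<le> 2 * (h - 1) \<and> card T \<le> 2 * (g - 1) \<and>
    k \<notin> colours c (P1 - S) \<inter> colours c (Q1 - T)"
    using bidense_kills_colour[OF fin1 P1X col P1(5)] by (rule allI)
  from choice[OF this] obtain S where "\<forall>k. \<exists>T. finite (S k) \<and> finite T \<and> card (S k) \<le> 2 * (h - 1) \<and>
    card T \<le> 2 * (g - 1) \<and> k \<notin> colours c (P1 - S k) \<inter> colours c (Q1 - T)" by (elim exE)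
  from choice[OF this] obtain T where "\<forall>k. finite (S k) \<and> finite (T k) \<and> card (S k) \<le> 2 * (h - 1) \<and>
    card (T k) \<le> 2 * (g - 1) \<and> k \<notin> colours c (P1 - S k) \<inter> colours c (Q1 - T k)" by (elim exE)
  then have ST: "\<And>k. card (S k) \<le> 2 * (h - 1)" "\<And>k. card (T k) \<le> 2 * (g - 1)"
    "\<And>k. k \<notin> colours c (P1 - S k) \<inter> colours c (Q1 - T k)" "\<And>k. finite (S k)" "\<And>k. finite (T k)"
    by simp_all
  \<comment> \<open>The deletions for all colours of \<open>K\<close> are carried out together; a
    deletion made for one colour cannot bring back another.\<close>
  define P2 Q2 where "P2 = P1 - (\<Union>k\<in>K. S k)" and "Q2 = Q1 - (\<Union>k\<in>K. T k)"
  have half: "real (card A) \<le> 2 * real (card (B - (\<Union>k\<in>K. S k)))"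
    if "finite A" "B \<subseteq> A" "card (A - B) \<le> (2 * q - 1) * h" "\<And>k. card (S k) \<le> 2 * (h - 1)"
      "real ((2 * q - 1) * h) \<le> real (card A) / 4" "real (q * (2 * (h - 1))) \<le> real (card A) / 4"
      "\<And>k. finite (S k)"
    for A B :: "'a set" and S h
  proof -
    have "finite K" using K fin finite_subset[OF K(1)] by simp
    have "card A \<le> card (A - B) + card (B \<inter> (\<Union>k\<in>K. S k)) + card (B - (\<Union>k\<in>K. S k))"
    proof -
      have "A = (A - B) \<union> (B \<inter> (\<Union>k\<in>K. S k)) \<union> (B - (\<Union>k\<in>K. S k))" using that(2) by blast
      then show ?thesis by (metis card_Un_le add_le_mono1 order_trans)
    qed
    moreover have "card (B \<inter> (\<Union>k\<in>K. S k)) \<le> q * (2 * (h - 1))"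
    proof -
      have "B \<inter> (\<Union>k\<in>K. S k) = (\<Union>k\<in>K. B \<inter> S k)" by blast
      moreover have "card (B \<inter> S k) \<le> 2 * (h - 1)" for k
        using that(4)[of k] card_mono[OF that(7)[of k], of "B \<inter> S k"] by simp
      ultimately have "card (B \<inter> (\<Union>k\<in>K. S k)) \<le> card K * (2 * (h - 1))"
        using card_UN_bounded[OF \<open>finite K\<close>, of "\<lambda>k. B \<inter> S k"] by simp
      also have "\<dots> \<le> q * (2 * (h - 1))" using K(2) by (rule mult_right_mono) simp
      finally show ?thesis .
    qed
    ultimately have "real (card A) \<le> real ((2 * q - 1) * h) + real (q * (2 * (h - 1))) + real (card (B - (\<Union>k\<in>K. S k)))"
      using that(3) by linarith
    then show ?thesis using that(5,6) by linarith
  qed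
  have "card P \<le> 2 * card P2" "card Q \<le> 2 * card Q2"
    using half[where A = P and B = P1 and S = S and h = h, OF fin(1) P1(1,3) ST(1) h(3,4) ST(4)] half[where A = Q and B = Q1 and S = T and h = g, OF fin(2) P1(2,4) ST(2) g(3,4) ST(5)]
    unfolding P2_def Q2_def by linarith+
  moreover have "k \<notin> colours c P2 \<inter> colours c Q2" if "k \<in> K" for k
  proof -
    have "colours c P2 \<subseteq> colours c (P1 - S k)" "colours c Q2 \<subseteq> colours c (Q1 - T k)"
      using that by (auto intro!: colours_mono simp: P2_def Q2_def)
    then show ?thesis using ST(3)[of k] by blast
  qed
  moreover have "P2 \<subseteq> P" "Q2 \<subseteq> Q" using P1 by (auto simp: P2_def Q2_def)
  ultimately show ?thesis by (intro exI[of _ P2] conjI exI[of _ Q2]) blast+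
qed

text \<open>The value of the potential at \<open>(X, X)\<close> bounds the sizes at its maximum from
  below. There at most \<open>q\<close> colours are common to both sides, and
  \<open>halve_sides\<close> removes them. Of two disjoint sets of colours one has at most n/2
  elements.\<close>

lemma halve_colours:
  assumes fin: "finite X" and col: "pairs_3col c X" and q: "q \<ge> 1" and two: "card X \<ge> 2"
    and n: "card (colours c X) \<le> n" "n \<ge> 1"
    and big: "200 * (real q)\<^sup>2 \<le> real (card X) * (1 / (2 * real n)) ^ (32 * q) * 2 powr - (8 / real q * real n)"
  shows "\<exists>Y\<subseteq>X. 2 * card (colours c Y) \<le> n \<and>
    real (card X) * (1 / (2 * real n)) ^ (32 * q) * 2 powr - (8 / real q * real n) \<le> 2 * real (card Y)"
proof -
  let ?N = "32 * q" and ?b = "8 / real q"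
  define m where "m = real (card X)"
  define R where "R = (1 / (2 * real n)) ^ ?N * 2 powr - (?b * real n)"
  have m: "m > 0" using two by (simp add: m_def)
  obtain i where i: "1 / (2 * real (card (colours c X))) \<le> dens {(u, v). u \<noteq> v \<and> c u v = i} X X"
    using dense_colour[OF fin two] by blast
  let ?E = "{(u, v). u \<noteq> v \<and> c u v = i}"
  have cpos: "card (colours c X) > 0"
  proof -
    obtain u v where "u \<in> X" "v \<in> X" "u \<noteq> v"
      using two card_le_Suc0_iff_eq[OF fin] by fastforce
    then have "colours c X \<noteq> {}" unfolding colours_def by blast
    then show ?thesis using fin by (simp add: card_gt_0_iff)
  qed
  have "1 / (2 * real n) \<le> 1 / (2 * real (card (colours c X)))"
    using cpos n by (intro divide_left_mono) auto
  then have i: "1 / (2 * real n) \<le> dens ?E X X" using i by linarith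
  \<comment> \<open>The weight 8/q makes \<open>q\<close> common colours worth 2^8, the factor by
    which \<open>half_density\<close> bounds the loss.\<close>
  define \<Psi> where "\<Psi> = (\<lambda>(P, Q). real (card P) * real (card Q) * dens ?E P Q ^ ?N
     * 2 powr - (?b * real (card (colours c P \<inter> colours c Q))))"
  let ?S = "{(P, Q). P \<subseteq> X \<and> Q \<subseteq> X \<and> P \<noteq> {} \<and> Q \<noteq> {}}"
  have finS: "finite ?S" by (rule finite_subset[of _ "Pow X \<times> Pow X"]) (use fin in auto)
  have XS: "(X, X) \<in> ?S" using two by auto
  then have neS: "?S \<noteq> {}" by blast
  obtain z where z: "z \<in> ?S" "\<forall>y\<in>?S. \<Psi> y \<le> \<Psi> z"
    using max_on_finite[OF finS neS, of \<Psi>] by (rule bexE)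
  obtain P Q where PQ: "z = (P, Q)" by (cases z)
  have sub: "P \<subseteq> X" "Q \<subseteq> X" and ne: "P \<noteq> {}" "Q \<noteq> {}" using z(1) PQ by auto
  have max: "\<Psi> (P', Q') \<le> \<Psi> (P, Q)" if "P' \<subseteq> P" "Q' \<subseteq> Q" "P' \<noteq> {}" "Q' \<noteq> {}" for P' Q'
    using bspec[OF z(2), of "(P', Q')"] that sub unfolding PQ by auto
  have finPQ: "finite P" "finite Q" using sub fin finite_subset by blast+
  let ?K = "colours c P \<inter> colours c Q"
  have finK: "finite ?K" using finPQ by simp
  have "m * m * R \<le> \<Psi> (X, X)"
  proof -
    have "(1 / (2 * real n)) ^ ?N \<le> dens ?E X X ^ ?N" using i by (intro power_mono) auto
    moreover have "2 powr - (?b * real n) \<le> 2 powr - (?b * real (card (colours c X \<inter> colours c X)))"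
      using n by (intro powr_mono) (auto intro!: divide_right_mono)
    ultimately have "R \<le> dens ?E X X ^ ?N * 2 powr - (?b * real (card (colours c X \<inter> colours c X)))"
      unfolding R_def by (intro mult_mono) auto
    then have "m * m * R \<le> m * m * (dens ?E X X ^ ?N * 2 powr - (?b * real (card (colours c X \<inter> colours c X))))"
      by (intro mult_left_mono) auto
    then show ?thesis unfolding \<Psi>_def m_def by (simp add: mult.assoc)
  qed
  also have "\<dots> \<le> \<Psi> (P, Q)" using bspec[OF z(2) XS] PQ by simp
  finally have low: "m * m * R \<le> \<Psi> (P, Q)" .
  have Rpos: "R > 0" unfolding R_def using n by simp
  have \<Psi>pos: "\<Psi> (P, Q) > 0" using low Rpos m by (smt (verit) mult_pos_pos)
  have dpos: "dens ?E P Q > 0"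
  proof (rule ccontr)
    assume "\<not> ?thesis"
    then have "dens ?E P Q = 0" using dens_nonneg[of ?E P Q] by linarith
    then show False using \<Psi>pos q by (simp add: \<Psi>_def power_0_left)
  qed
  have "\<Psi> (P, Q) \<le> real (card P) * real (card Q)"
  proof -
    have "dens ?E P Q ^ ?N \<le> 1" by (intro power_le_one dens_nonneg dens_le_1)
    moreover have "2 powr - (?b * real (card ?K)) \<le> 2 powr 0" by (intro powr_mono) auto
    ultimately have "dens ?E P Q ^ ?N * 2 powr - (?b * real (card ?K)) \<le> 1 * 1"
      by (intro mult_mono) auto
    then have "real (card P) * real (card Q) * (dens ?E P Q ^ ?N * 2 powr - (?b * real (card ?K)))
       \<le> real (card P) * real (card Q) * (1 * 1)" by (intro mult_left_mono) auto
    then show ?thesis by (simp add: \<Psi>_def mult.assoc)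
  qed
  with low have PQlow: "m * m * R \<le> real (card P) * real (card Q)" by linarith
  have Pm: "real (card P) \<le> m" "real (card Q) \<le> m"
    using sub fin by (auto simp: m_def intro!: card_mono)
  \<comment> \<open>Neither side exceeds \<open>m\<close>, so a product of at least
    \<open>m * m * R\<close> makes each side at least \<open>m * R\<close>.\<close>
  have Plow: "m * R \<le> real (card P)"
  proof -
    have "m * (m * R) \<le> m * real (card P)"
      using PQlow mult_left_mono[OF Pm(2), of "real (card P)"] by (simp add: mult_ac)
    then show ?thesis using m by simp
  qed
  have Qlow: "m * R \<le> real (card Q)"
  proof -
    have "m * (m * R) \<le> m * real (card Q)"
      using PQlow mult_right_mono[OF Pm(1), of "real (card Q)"] by (simp add: mult_ac)
    then show ?thesis using m by simp
  qed
  have big': "200 * (real q)\<^sup>2 \<le> m * R" using big by (simp add: m_def R_def mult.assoc)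
  have bigPQ: "card P \<ge> 200 * q\<^sup>2" "card Q \<ge> 200 * q\<^sup>2"
  proof -
    have "real (200 * q\<^sup>2) \<le> real (card P)" "real (200 * q\<^sup>2) \<le> real (card Q)"
      using big' Plow Qlow by simp_all
    then show "card P \<ge> 200 * q\<^sup>2" "card Q \<ge> 200 * q\<^sup>2" by (simp_all only: of_nat_le_iff)
  qed
  \<comment> \<open>On subsets the common colours can only decrease, so the last factor of
    \<open>\<Psi>\<close> only grows and can be cancelled.\<close>
  have M: "dense_max ?E P Q ?N"
    unfolding dense_max_def
  proof (intro allI impI)
    fix P' Q' assume *: "P' \<subseteq> P" "Q' \<subseteq> Q" "P' \<noteq> {}" "Q' \<noteq> {}"
    have "card (colours c P' \<inter> colours c Q') \<le> card ?K"
      using colours_mono[OF *(1), of c] colours_mono[OF *(2), of c] finK by (intro card_mono) auto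
    then have "2 powr - (?b * real (card ?K)) \<le> 2 powr - (?b * real (card (colours c P' \<inter> colours c Q')))"
      by (intro powr_mono) (auto intro!: divide_right_mono)
    then have "real (card P') * real (card Q') * dens ?E P' Q' ^ ?N * 2 powr - (?b * real (card ?K)) \<le> \<Psi> (P', Q')"
      unfolding \<Psi>_def split by (intro mult_left_mono) auto
    also have "\<dots> \<le> \<Psi> (P, Q)" using max * by blast
    finally show "real (card P') * real (card Q') * dens ?E P' Q' ^ ?N \<le> real (card P) * real (card Q) * dens ?E P Q ^ ?N"
      unfolding \<Psi>_def split by simp
  qed
  note halve = halve_sides[OF finPQ sub col M q dpos bigPQ]
  \<comment> \<open>Otherwise removing \<open>q\<close> common colours would gain 2^8 and lose
    strictly less, against maximality.\<close>
  have Kq: "card ?K \<le> q"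
  proof (rule ccontr)
    assume "\<not> ?thesis"
    then have "q \<le> card ?K" by simp
    from obtain_subset_with_card_n[OF this] obtain K0 where K0: "K0 \<subseteq> ?K" "card K0 = q" by blast
    obtain P' Q' where h: "P' \<subseteq> P" "Q' \<subseteq> Q" "card P \<le> 2 * card P'" "card Q \<le> 2 * card Q'"
      "K0 \<inter> colours c P' \<inter> colours c Q' = {}"
      using halve[OF K0(1) eq_imp_le[OF K0(2)]] by (elim exE conjE)
    have q2: "q\<^sup>2 \<ge> 1" using q by simp
    \<comment> \<open>\<open>half_density\<close> wants sides of at most 51/100, so the halves are
      trimmed to \<open>B\<close> / 2 rounded up; \<open>B\<close> at least 200 makes the rounding
      fit.\<close>
    have shrink: "\<exists>A'\<subseteq>A. real B / 2 \<le> real (card A') \<and> real (card A') \<le> 51/100 * real B"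
      if "B \<le> 2 * card A" "B \<ge> 200 * q\<^sup>2" for A :: "'a set" and B :: nat
    proof -
      have "(B + 1) div 2 \<le> card A" using that by linarith
      from obtain_subset_with_card_n[OF this] obtain A' where A': "A' \<subseteq> A" "card A' = (B + 1) div 2" by blast
      have "B \<ge> 200" using that q2 by linarith
      have "B \<le> 2 * card A'" "2 * card A' \<le> B + 1" unfolding A'(2) by linarith+
      then have "real B / 2 \<le> real (card A')" "real (card A') \<le> 51/100 * real B" using \<open>B \<ge> 200\<close> by linarith+
      then show ?thesis using A' by blast
    qed
    obtain P3 where P3: "P3 \<subseteq> P'" "real (card P) / 2 \<le> real (card P3)" "real (card P3) \<le> 51/100 * real (card P)"
      using shrink[OF h(3) bigPQ(1)] by blast
    obtain Q3 where Q3: "Q3 \<subseteq> Q'" "real (card Q) / 2 \<le> real (card Q3)" "real (card Q3) \<le> 51/100 * real (card Q)"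
      using shrink[OF h(4) bigPQ(2)] by blast
    have sub3: "P3 \<subseteq> P" "Q3 \<subseteq> Q" using P3 Q3 h by auto
    have "card P > 0" "card Q > 0" using ne finPQ by (simp_all add: card_gt_0_iff)
    then have ne3: "P3 \<noteq> {}" "Q3 \<noteq> {}" using P3 Q3 by auto
    let ?K3 = "colours c P3 \<inter> colours c Q3"
    have "?K3 \<subseteq> ?K - K0"
      using h(5) colours_mono[OF P3(1), of c] colours_mono[OF Q3(1), of c]
        colours_mono[OF sub3(1), of c] colours_mono[OF sub3(2), of c] by blast
    then have "card ?K3 \<le> card (?K - K0)" using finK by (intro card_mono) auto
    also have "\<dots> = card ?K - q" using K0 finK by (metis card_Diff_subset finite_subset)
    finally have "card ?K3 + q \<le> card ?K" using K0 finK card_mono[OF finK K0(1)] by linarith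
    then have "real (card ?K3) \<le> real (card ?K) - real q" by linarith
    then have "?b * real (card ?K3) \<le> ?b * (real (card ?K) - real q)" by (intro mult_left_mono) auto
    also have "\<dots> = ?b * real (card ?K) - 8" using q by (simp add: right_diff_distrib)
    finally have "8 - ?b * real (card ?K) \<le> - (?b * real (card ?K3))" by linarith
    then have "2 powr (8 - ?b * real (card ?K)) \<le> 2 powr - (?b * real (card ?K3))"
      by (intro powr_mono) auto
    moreover have "2 powr (8 - ?b * real (card ?K)) = 2 ^ 8 * 2 powr - (?b * real (card ?K))"
      by (simp add: powr_diff powr_minus divide_inverse)
    ultimately have K3: "2 ^ 8 * 2 powr - (?b * real (card ?K)) \<le> 2 powr - (?b * real (card ?K3))"
      by (simp only:)
    have "real (card P) * real (card Q) * dens ?E P Q ^ ?N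
      < 2 ^ 8 * (real (card P3) * real (card Q3) * dens ?E P3 Q3 ^ ?N)"
      by (rule half_density[OF M finPQ q dpos sub3 P3(2,3) Q3(2,3)])
    then have "\<Psi> (P, Q) < 2 ^ 8 * (real (card P3) * real (card Q3) * dens ?E P3 Q3 ^ ?N) * 2 powr - (?b * real (card ?K))"
      unfolding \<Psi>_def split by (intro mult_strict_right_mono) auto
    also have "\<dots> = (real (card P3) * real (card Q3) * dens ?E P3 Q3 ^ ?N) * (2 ^ 8 * 2 powr - (?b * real (card ?K)))"
      by simp
    also have "\<dots> \<le> \<Psi> (P3, Q3)"
      unfolding \<Psi>_def split using K3 by (intro mult_left_mono) auto
    finally show False using max[OF sub3 ne3] by linarith
  qed
  obtain P' Q' where h: "P' \<subseteq> P" "Q' \<subseteq> Q" "card P \<le> 2 * card P'" "card Q \<le> 2 * card Q'"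
    "?K \<inter> colours c P' \<inter> colours c Q' = {}"
    using halve[OF order_refl Kq] by (elim exE conjE)
  have dis: "colours c P' \<inter> colours c Q' = {}"
    using h(5) colours_mono[OF h(1), of c] colours_mono[OF h(2), of c] by blast
  have finP': "finite P'" "finite Q'" using h finPQ finite_subset by blast+
  have "colours c P' \<union> colours c Q' \<subseteq> colours c X"
    using colours_mono[of P' X c] colours_mono[of Q' X c] h sub by blast
  then have "card (colours c P') + card (colours c Q') \<le> card (colours c X)"
    using card_Un_disjoint[OF _ _ dis] card_mono[of "colours c X" "colours c P' \<union> colours c Q'"] fin finP' by simp
  then have "2 * card (colours c P') \<le> n \<or> 2 * card (colours c Q') \<le> n" using n by linarith
  moreover have "m * R \<le> 2 * real (card P')" "m * R \<le> 2 * real (card Q')"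
    using Plow Qlow h(3,4) by linarith+
  moreover have "P' \<subseteq> X" "Q' \<subseteq> X" using h sub by auto
  ultimately show ?thesis unfolding m_def R_def mult.assoc[symmetric] by blast
qed

text \<open>Strong induction through \<open>halve_colours\<close>, with the bound \<open>L\<close>
  on the logarithm of 2n fixed while \<open>n\<close> halves. Halving \<open>n\<close> lowers the
  leading coefficient from 125 to about 125 / sqrt 2, and adding the 32 lost in one round still
  stays below 125. The term \<open>3200 * L\<close> pays for the crude bound when \<open>n\<close>
  is below \<open>1600 * L\<close>.\<close>

lemma card_bound:
  fixes L :: real
  assumes "finite X" "pairs_3col c X" "card (colours c X) \<le> n" "L \<ge> 1" "2 * real n \<le> 2 powr L"
  shows "real (card X) \<le> 2 powr (125 * sqrt (real n * L) + 3200 * L)"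
  using assms
proof (induction n arbitrary: X rule: less_induct)
  case (less n)
  have L: "L \<ge> 1" by fact
  show ?case
  proof (cases "real n < 1600 * L")
    case True
    have "card X \<le> 3 ^ n" using card_le_3_power less.prems by blast
    also have "\<dots> \<le> 4 ^ n" by (intro power_mono) auto
    finally have "real (card X) \<le> 4 ^ n" by (metis of_nat_le_iff of_nat_numeral of_nat_power)
    also have "\<dots> = 2 powr (2 * real n)" by (simp add: powr_powr[symmetric] powr_realpow)
    also have "\<dots> \<le> 2 powr (125 * sqrt (real n * L) + 3200 * L)"
    proof (intro powr_mono)
      have "0 \<le> sqrt (real n * L)" using L by simp
      then show "2 * real n \<le> 125 * sqrt (real n * L) + 3200 * L" using True by linarith
    qed auto
    finally show ?thesis .
  next
    case False
    define w where "w = sqrt (real n / L)"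
    have n0: "real n \<ge> 1600 * L" using False by simp
    then have n1: "n \<ge> 1" using L by (cases n) auto
    have "sqrt (40\<^sup>2) \<le> w" unfolding w_def using n0 L by (intro real_sqrt_le_mono) (simp add: field_simps)
    then have w: "w \<ge> 40" by simp
    have nw: "real n = w * w * L" unfolding w_def using L by simp
    have sq: "sqrt (real n * L) = w * L"
    proof -
      have "real n * L = (w * L)\<^sup>2" unfolding nw by (simp add: power2_eq_square)
      then show ?thesis using w L by simp
    qed
    have wL: "w * L \<ge> 40 * L" using w L by (intro mult_right_mono) auto
    \<comment> \<open>Since \<open>n = w * w * L\<close>, this choice balances the two factors of
      \<open>R\<close>: each is about 2 to the power -16wL. Rounding up costs at most
      \<open>32 * L\<close> in the exponent.\<close>
    define q where "q = nat \<lceil>w / 2\<rceil>"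
    have q: "w / 2 \<le> real q" "real q \<le> w / 2 + 1" unfolding q_def using w by linarith+
    have q1: "q \<ge> 1" using q w by (cases q) auto
    define R where "R = (1 / (2 * real n)) ^ (32 * q) * 2 powr - (8 / real q * real n)"
    have R: "2 powr - (32 * (w * L) + 32 * L) \<le> R"
    proof -
      have "1 / 2 powr L \<le> 1 / (2 * real n)" using less.prems(5) n1 by (intro divide_left_mono) auto
      then have "(1 / 2 powr L) ^ (32 * q) \<le> (1 / (2 * real n)) ^ (32 * q)" by (intro power_mono) auto
      moreover have "(1 / 2 powr L) ^ (32 * q) = 2 powr - (L * (32 * real q))"
      proof -
        have "(1 / 2 powr L) ^ (32 * q) = (2 powr - L) powr (32 * real q)"
          by (subst powr_realpow[symmetric]) (auto simp: powr_minus_divide)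
        also have "\<dots> = 2 powr - (L * (32 * real q))" by (simp add: powr_powr)
        finally show ?thesis .
      qed
      moreover have "2 powr - (16 * (w * L) + 32 * L) \<le> 2 powr - (L * (32 * real q))"
      proof (intro powr_mono)
        have "L * (32 * real q) \<le> L * (32 * (w / 2 + 1))" using q L by (intro mult_left_mono) auto
        then show "- (16 * (w * L) + 32 * L) \<le> - (L * (32 * real q))" by (simp add: algebra_simps)
      qed auto
      ultimately have 1: "2 powr - (16 * (w * L) + 32 * L) \<le> (1 / (2 * real n)) ^ (32 * q)" by linarith
      have "8 / real q * real n \<le> 8 / (w / 2) * real n"
        using q w by (intro mult_right_mono divide_left_mono) auto
      also have "\<dots> = 16 * (w * L)" unfolding nw using w by simp
      finally have 2: "2 powr - (16 * (w * L)) \<le> 2 powr - (8 / real q * real n)"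
        by (intro powr_mono) auto
      have "2 powr - (32 * (w * L) + 32 * L) = 2 powr - (16 * (w * L) + 32 * L) * 2 powr - (16 * (w * L))"
        by (simp add: powr_add[symmetric] algebra_simps)
      also have "\<dots> \<le> R" unfolding R_def using 1 2 by (intro mult_mono) auto
      finally show ?thesis .
    qed
    have solve: "real (card X) \<le> 2 powr s * 2 powr (32 * (w * L) + 32 * L)"
      if "real (card X) * R \<le> 2 powr s" for s
    proof -
      have "real (card X) * 2 powr - (32 * (w * L) + 32 * L) \<le> 2 powr s"
        using mult_left_mono[OF R, of "real (card X)"] that by simp
      then have "real (card X) * 2 powr - (32 * (w * L) + 32 * L) * 2 powr (32 * (w * L) + 32 * L)
         \<le> 2 powr s * 2 powr (32 * (w * L) + 32 * L)" by (intro mult_right_mono) auto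
      then show ?thesis by (simp add: mult.assoc powr_add[symmetric])
    qed
    consider "card X < 2" | "card X \<ge> 2" "real (card X) * R < 200 * (real q)\<^sup>2"
      | "card X \<ge> 2" "200 * (real q)\<^sup>2 \<le> real (card X) * R" by linarith
    then show ?thesis
    proof cases
      case 1
      have "real (card X) \<le> 2 powr 0" using 1 by simp
      also have "\<dots> \<le> 2 powr (125 * sqrt (real n * L) + 3200 * L)"
        unfolding sq using wL L by (intro powr_mono) linarith+
      finally show ?thesis .
    next
      case 2
      \<comment> \<open>Here \<open>X\<close> is too small for \<open>halve_colours\<close>. As
        \<open>q\<close> is at most \<open>w\<close>, q^2 is at most \<open>n\<close>, and 200n is
        at most 2^7 times 2n.\<close>
      have "(real q)\<^sup>2 \<le> w\<^sup>2" using q w by (intro power_mono) auto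
      also have "\<dots> \<le> w\<^sup>2 * L" using mult_left_mono[OF L, of "w\<^sup>2"] by simp
      finally have "(real q)\<^sup>2 \<le> real n" unfolding nw by (simp add: power2_eq_square)
      then have "200 * (real q)\<^sup>2 \<le> 128 * (2 * real n)" by linarith
      also have "\<dots> \<le> 2 powr 7 * 2 powr L" using less.prems(5) by simp
      also have "\<dots> = 2 powr (7 + L)" by (simp add: powr_add)
      finally have "real (card X) * R \<le> 2 powr (7 + L)" using 2 by linarith
      from solve[OF this] have "real (card X) \<le> 2 powr (7 + L + (32 * (w * L) + 32 * L))"
        by (simp only: powr_add mult.assoc)
      also have "\<dots> \<le> 2 powr (125 * sqrt (real n * L) + 3200 * L)"
        unfolding sq using wL L by (intro powr_mono) linarith+
      finally show ?thesis .
    next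
      case 3
      obtain Y where Y: "Y \<subseteq> X" "2 * card (colours c Y) \<le> n" "real (card X) * R \<le> 2 * real (card Y)"
        using halve_colours[OF less.prems(1,2) q1 3(1) less.prems(3) n1] 3(2)
        unfolding R_def by (auto simp: mult.assoc)
      have "real (card Y) \<le> 2 powr (125 * sqrt (real (n div 2) * L) + 3200 * L)"
      proof (rule less.IH)
        show "n div 2 < n" using n1 by simp
        show "finite Y" using less.prems(1) Y(1) finite_subset by blast
        show "pairs_3col c Y" using pairs_3col_subset less.prems(2) Y(1) by blast
        show "card (colours c Y) \<le> n div 2" using Y(2) by linarith
        have "real (n div 2) \<le> real n" by simp
        then show "2 * real (n div 2) \<le> 2 powr L" using less.prems(5) by linarith
      qed (fact L)
      \<comment> \<open>442/625 is slightly above 1 / sqrt 2, and 125 times it is 442/5.\<close>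
      moreover have "sqrt (real (n div 2) * L) \<le> 442/625 * (w * L)"
      proof (rule real_le_lsqrt)
        have "2 * real (n div 2) \<le> real n" by linarith
        then have "real (n div 2) * L \<le> real n / 2 * L" using L by (intro mult_right_mono) auto
        also have "\<dots> = 1/2 * (w * L)\<^sup>2" unfolding nw by (simp add: power2_eq_square)
        also have "\<dots> \<le> (442/625)\<^sup>2 * (w * L)\<^sup>2" by (intro mult_right_mono) (auto simp: power2_eq_square)
        finally show "real (n div 2) * L \<le> (442/625 * (w * L))\<^sup>2" by (simp only: power_mult_distrib)
      qed (use w L in auto)
      then have "2 powr (125 * sqrt (real (n div 2) * L) + 3200 * L) \<le> 2 powr (442/5 * (w * L) + 3200 * L)"
        by (intro powr_mono) auto
      ultimately have "real (card X) * R \<le> 2 * 2 powr (442/5 * (w * L) + 3200 * L)" using Y(3) by linarith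
      also have "\<dots> = 2 powr (1 + (442/5 * (w * L) + 3200 * L))" by (simp add: powr_add)
      finally have "real (card X) * R \<le> 2 powr (1 + (442/5 * (w * L) + 3200 * L))" .
      from solve[OF this] have "real (card X) \<le> 2 powr (1 + (442/5 * (w * L) + 3200 * L) + (32 * (w * L) + 32 * L))"
        by (simp only: powr_add mult.assoc)
      \<comment> \<open>The margin 125 - 442/5 - 32 = 23/5 times \<open>w * L\<close> is at least
        \<open>184 * L\<close>, which covers \<open>1 + 32 * L\<close>.\<close>
      also have "\<dots> \<le> 2 powr (125 * sqrt (real n * L) + 3200 * L)"
        unfolding sq using wL L by (intro powr_mono) linarith+
      finally show ?thesis .
    qed
  qed
qed

section \<open>Chromatic number and the grid colouring\<close>

lemma edges_of_iff: "{u, v} \<in> edges_of V \<longleftrightarrow> u \<in> V \<and> v \<in> V \<and> u \<noteq> v"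
  unfolding edges_of_def by (auto simp: doubleton_eq_iff)

lemma chromatic_number_le: "proper_colouring V E f k \<Longrightarrow> chromatic_number V E \<le> k"
  unfolding chromatic_number_def by (intro Least_le) blast

lemma chromatic_number_attained:
  assumes "finite V"
  obtains f where "proper_colouring V E f (chromatic_number V E)"
proof -
  obtain k where "V \<subseteq> {..<k}" using assms finite_nat_set_iff_bounded[of V] by auto
  then have "proper_colouring V E (\<lambda>v. v) k" by (auto simp: proper_colouring_def)
  then have "\<exists>f. proper_colouring V E f (chromatic_number V E)"
    unfolding chromatic_number_def by (intro LeastI) blast
  then show ?thesis using that by blast
qed

lemma chromatic_number_insert_le:
  assumes "finite V"
  shows "chromatic_number (insert x V) (E \<inter> edges_of (insert x V)) \<le> Suc (chromatic_number V (E \<inter> edges_of V))"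
proof -
  define k where "k = chromatic_number V (E \<inter> edges_of V)"
  obtain f where f: "proper_colouring V (E \<inter> edges_of V) f k"
    unfolding k_def by (rule chromatic_number_attained[OF assms])
  have fk: "f v < k" if "v \<in> V" for v using f that unfolding proper_colouring_def by auto
  have "proper_colouring (insert x V) (E \<inter> edges_of (insert x V)) (f(x := k)) (Suc k)"
    unfolding proper_colouring_def
  proof (intro conjI allI impI)
    show "(f(x := k)) ` insert x V \<subseteq> {..<Suc k}" using fk by (auto simp: less_Suc_eq)
    fix u v assume uv: "{u, v} \<in> E \<inter> edges_of (insert x V)" "u \<noteq> v"
    then have in_xV: "u \<in> insert x V" "v \<in> insert x V" by (auto simp: edges_of_iff)
    show "(f(x := k)) u \<noteq> (f(x := k)) v"
    proof (cases "u = x \<or> v = x")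
      case True
      then show ?thesis using in_xV uv(2) fk by (metis fun_upd_apply insertE less_irrefl)
    next
      case False
      then have "{u, v} \<in> E \<inter> edges_of V" using in_xV uv by (auto simp: edges_of_iff)
      then show ?thesis using f uv(2) False unfolding proper_colouring_def by auto
    qed
  qed
  then show ?thesis unfolding k_def by (rule chromatic_number_le)
qed

text \<open>Adding the vertices one by one starts at chromatic number 0 and raises it by at most 1
  each time, so no value is skipped. This supplies the exact value that \<open>F_chi\<close> asks
  for.\<close>

lemma induced_subgraph_of_chromatic_number:
  assumes "finite V" "p \<le> chromatic_number V (E \<inter> edges_of V)"
  shows "\<exists>V'\<subseteq>V. chromatic_number V' (E \<inter> edges_of V') = p"
  using assms
proof (induction V)
  case empty
  have "proper_colouring {} (E \<inter> edges_of {}) (\<lambda>v. v) 0"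
    by (auto simp: proper_colouring_def edges_of_iff)
  then have "chromatic_number {} (E \<inter> edges_of {}) = 0" using chromatic_number_le by blast
  then show ?case using empty by auto
next
  case (insert x V)
  show ?case
  proof (cases "p \<le> chromatic_number V (E \<inter> edges_of V)")
    case True
    then show ?thesis using insert.IH by blast
  next
    case False
    then have "chromatic_number (insert x V) (E \<inter> edges_of (insert x V)) = p"
      using chromatic_number_insert_le[OF insert.hyps(1), of x E] insert.prems by linarith
    then show ?thesis by blast
  qed
qed

section \<open>Mubayi's colouring of the grid\<close>

text \<open>The vertex \<open>v\<close> stands for the vector \<open>g v\<close> with
  \<open>t\<close> coordinates. Quantifying over both ends and taking an image makes the colour
  depend on the unordered edge only.\<close>

definition mubayi :: "(nat \<Rightarrow> nat \<Rightarrow> nat) \<Rightarrow> nat \<Rightarrow> nat set \<Rightarrow> nat set \<times> nat set" where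
  "mubayi g t e = (let D = {j. j < t \<and> (\<exists>u\<in>e. \<exists>v\<in>e. g u j \<noteq> g v j)} in (D, (\<lambda>v. g v (Min D)) ` e))"

lemma mubayi_edge:
  assumes "mubayi g t {u, v} = (D, S)" "\<exists>j<t. g u j \<noteq> g v j"
  shows "Min D < t" "\<And>j. j < t \<Longrightarrow> j \<in> D \<longleftrightarrow> g u j \<noteq> g v j" "\<And>j. j < Min D \<Longrightarrow> g u j = g v j"
    "S = {g u (Min D), g v (Min D)}" "g u (Min D) \<noteq> g v (Min D)"
proof -
  have D: "D = {j. j < t \<and> g u j \<noteq> g v j}" and S: "S = {g u (Min D), g v (Min D)}"
    using assms(1) unfolding mubayi_def Let_def by auto
  have "finite D" "D \<noteq> {}" using assms(2) D by auto
  then have M: "Min D \<in> D" by simp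
  show "Min D < t" "g u (Min D) \<noteq> g v (Min D)" using M unfolding D by auto
  show "S = {g u (Min D), g v (Min D)}" by (fact S)
  show "j \<in> D \<longleftrightarrow> g u j \<noteq> g v j" if "j < t" for j using that D by auto
  show "g u j = g v j" if "j < Min D" for j
  proof (rule ccontr)
    assume "g u j \<noteq> g v j"
    then have "j \<in> D" using that \<open>Min D < t\<close> unfolding D by auto
    then show False using that \<open>finite D\<close> by (meson Min_le not_less)
  qed
qed

text \<open>\<open>a\<close> maps all edges to the graph with the edges \<open>{x, y}\<close> and
  \<open>{x', y'}\<close>. If these are disjoint, two classes suffice; otherwise \<open>x\<close>,
  \<open>y\<close> and all remaining values form three classes.\<close>

lemma three_colouring_same_coordinate:
  fixes a :: "'v \<Rightarrow> nat"
  assumes ne: "x \<noteq> y" "x' \<noteq> y'"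
    and A: "\<And>u v. A u v \<Longrightarrow> {a u, a v} = {x, y}"
    and B: "\<And>u v. B u v \<Longrightarrow> {a u, a v} = {x', y'}"
  shows "\<exists>f::'v \<Rightarrow> nat. (\<forall>v. f v < 3) \<and> (\<forall>u v. A u v \<or> B u v \<longrightarrow> f u \<noteq> f v)"
proof -
  let ?f = "\<lambda>v. if x' \<notin> {x, y} \<and> y' \<notin> {x, y} then if a v = x \<or> a v = x' then 0 else 1
    else if a v = x then 0 else if a v = y then 1 else 2 :: nat"
  have "?f u \<noteq> ?f v" if "A u v" for u v
  proof -
    have "a u = x \<and> a v = y \<or> a u = y \<and> a v = x" using A[OF that] by (simp add: doubleton_eq_iff)
    then show ?thesis using ne by (elim disjE conjE) auto
  qed
  moreover have "?f u \<noteq> ?f v" if "B u v" for u v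
  proof -
    have "a u = x' \<and> a v = y' \<or> a u = y' \<and> a v = x'" using B[OF that] by (simp add: doubleton_eq_iff)
    then show ?thesis using ne by (elim disjE conjE) auto
  qed
  moreover have "?f v < 3" for v by simp
  ultimately show ?thesis by (intro exI[of _ ?f]) blast
qed

text \<open>If \<open>s\<close> holds, vertices with \<open>a\<close> in \<open>{x, y}\<close> and
  \<open>b\<close> equal to \<open>y'\<close> get colour 1. The first relation changes
  \<open>b\<close>, so it never joins two of them, and an edge of the second has exactly one end
  where \<open>b\<close> is \<open>y'\<close>. The rest of the rows \<open>x\<close> and
  \<open>y\<close> gets 0 and 2; other rows meet only the second relation.\<close>

lemma three_colouring_two_coordinates:
  fixes a b :: "'v \<Rightarrow> nat"
  assumes ne: "x \<noteq> y" "x' \<noteq> y'"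
    and A: "\<And>u v. A u v \<Longrightarrow> {a u, a v} = {x, y} \<and> (s \<longleftrightarrow> b u \<noteq> b v)"
    and B: "\<And>u v. B u v \<Longrightarrow> a u = a v \<and> {b u, b v} = {x', y'}"
  shows "\<exists>f::'v \<Rightarrow> nat. (\<forall>v. f v < 3) \<and> (\<forall>u v. A u v \<or> B u v \<longrightarrow> f u \<noteq> f v)"
proof -
  \<comment> \<open>If \<open>\<not> s\<close>, the first relation flips only \<open>a\<close> and the second only \<open>b\<close>, so parity is a 2-colouring.\<close>
  let ?f = "\<lambda>v. if \<not> s then if (a v = x) = (b v = x') then 0 else 1
    else if a v = x then (if b v = y' then 1 else 0)
    else if a v = y then (if b v = y' then 1 else 2) else (if b v = x' then 0 else 1 :: nat)"
  have "?f u \<noteq> ?f v" if "A u v" for u v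
  proof -
    have "a u = x \<and> a v = y \<or> a u = y \<and> a v = x" "s \<longleftrightarrow> b u \<noteq> b v"
      using A[OF that] by (simp_all add: doubleton_eq_iff)
    then show ?thesis using ne by (elim disjE conjE) auto
  qed
  moreover have "?f u \<noteq> ?f v" if "B u v" for u v
  proof -
    have "b u = x' \<and> b v = y' \<or> b u = y' \<and> b v = x'" "a u = a v"
      using B[OF that] by (simp_all add: doubleton_eq_iff)
    then show ?thesis using ne by (elim disjE conjE) auto
  qed
  moreover have "?f v < 3" for v by simp
  ultimately show ?thesis by (intro exI[of _ ?f]) blast
qed

definition mubayi_adj :: "(nat \<Rightarrow> nat \<Rightarrow> nat) \<Rightarrow> nat \<Rightarrow> nat set \<Rightarrow> nat set \<times> nat set \<Rightarrow> nat \<Rightarrow> nat \<Rightarrow> bool" where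
  "mubayi_adj g t X \<alpha> u v \<longleftrightarrow> u \<in> X \<and> v \<in> X \<and> u \<noteq> v \<and> mubayi g t {u, v} = \<alpha>"

text \<open>Edges of the second colour agree before coordinate \<open>Min D'\<close>. Along the
  first colour the set \<open>D\<close> decides, for all its edges alike, whether coordinate
  \<open>Min D'\<close> changes; this is why a colour records all of \<open>D\<close>.\<close>

lemma mubayi_three_colouring_used:
  assumes sep: "\<And>u v. u \<in> X \<Longrightarrow> v \<in> X \<Longrightarrow> u \<noteq> v \<Longrightarrow> \<exists>j<t. g u j \<noteq> g v j"
  defines "U \<equiv> mubayi_adj g t X"
  assumes used: "U (D, S) u1 v1" "U (D', S') u2 v2" and le: "Min D \<le> Min D'"
  shows "\<exists>f::nat \<Rightarrow> nat. (\<forall>v. f v < 3) \<and> (\<forall>u v. U (D, S) u v \<or> U (D', S') u v \<longrightarrow> f u \<noteq> f v)"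
proof -
  have E: "Min D < t" "\<And>j. j < t \<Longrightarrow> j \<in> D \<longleftrightarrow> g u j \<noteq> g v j" "\<And>j. j < Min D \<Longrightarrow> g u j = g v j"
    "S = {g u (Min D), g v (Min D)}" "g u (Min D) \<noteq> g v (Min D)" if "U (D, S) u v" for u v D S
  proof -
    have m: "mubayi g t {u, v} = (D, S)" "\<exists>j<t. g u j \<noteq> g v j"
      using that sep unfolding U_def mubayi_adj_def by blast+
    show "Min D < t" by (rule mubayi_edge(1)[OF m])
    show "j \<in> D \<longleftrightarrow> g u j \<noteq> g v j" if "j < t" for j by (rule mubayi_edge(2)[OF m that])
    show "g u j = g v j" if "j < Min D" for j by (rule mubayi_edge(3)[OF m that])
    show "S = {g u (Min D), g v (Min D)}" by (rule mubayi_edge(4)[OF m])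
    show "g u (Min D) \<noteq> g v (Min D)" by (rule mubayi_edge(5)[OF m])
  qed
  define x y x' y' where "x = g u1 (Min D)" and "y = g v1 (Min D)"
    and "x' = g u2 (Min D')" and "y' = g v2 (Min D')"
  have S: "S = {x, y}" "x \<noteq> y" "S' = {x', y'}" "x' \<noteq> y'"
    using E(4,5)[OF used(1)] E(4,5)[OF used(2)] by (auto simp: x_def y_def x'_def y'_def)
  have A: "{g u (Min D), g v (Min D)} = {x, y} \<and> (Min D' \<in> D \<longleftrightarrow> g u (Min D') \<noteq> g v (Min D'))"
    if "U (D, S) u v" for u v using E(2,4)[OF that] E(1)[OF used(2)] S by blast
  have B: "{g u (Min D'), g v (Min D')} = {x', y'}" if "U (D', S') u v" for u v
    using E(4)[OF that] S by blast
  show ?thesis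
  proof (cases "Min D = Min D'")
    case True
    show ?thesis
      by (rule three_colouring_same_coordinate[of x y x' y' _ "\<lambda>v. g v (Min D)"])
        (use S A B True in auto)
  next
    case False
    then have "g u (Min D) = g v (Min D)" if "U (D', S') u v" for u v using E(3)[OF that] le by simp
    then show ?thesis
      using three_colouring_two_coordinates[of x y x' y' "U (D, S)" "\<lambda>v. g v (Min D)" "Min D' \<in> D"
          "\<lambda>v. g v (Min D')" "U (D', S')"] S A B by blast
  qed
qed

lemma mubayi_three_colouring:
  assumes sep: "\<And>u v. u \<in> X \<Longrightarrow> v \<in> X \<Longrightarrow> u \<noteq> v \<Longrightarrow> \<exists>j<t. g u j \<noteq> g v j"
  shows "\<exists>f::nat \<Rightarrow> nat. (\<forall>v. f v < 3) \<and>
    (\<forall>u v. u \<in> X \<and> v \<in> X \<and> u \<noteq> v \<and> mubayi g t {u, v} \<in> {\<alpha>, \<beta>} \<longrightarrow> f u \<noteq> f v)"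
proof -
  let ?U = "mubayi_adj g t X"
  let ?T = "\<lambda>\<alpha> \<beta>. \<exists>f::nat \<Rightarrow> nat. (\<forall>v. f v < 3) \<and> (\<forall>u v. ?U \<alpha> u v \<or> ?U \<beta> u v \<longrightarrow> f u \<noteq> f v)"
  have both: "?T \<alpha> \<beta>" if "?U \<alpha> u1 v1" "?U \<beta> u2 v2" for \<alpha> \<beta> u1 v1 u2 v2
  proof -
    obtain D S D' S' where eq: "\<alpha> = (D, S)" "\<beta> = (D', S')" by (cases \<alpha>, cases \<beta>)
    have used: "?T (D, S) (D', S')" if "?U (D, S) u1 v1" "?U (D', S') u2 v2" "Min D \<le> Min D'"
      for D S D' S' u1 v1 u2 v2
      by (rule mubayi_three_colouring_used) (use sep that in auto)
    show ?thesis
    proof (cases "Min D \<le> Min D'")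
      case True
      then show ?thesis using used that unfolding eq by blast
    next
      case False
      then have "?T \<beta> \<alpha>" using used[of D' S' u2 v2 D S u1 v1] that unfolding eq by simp
      then show ?thesis by (simp only: disj_commute)
    qed
  qed
  have "?T \<alpha> \<beta>"
  proof (cases "(\<exists>u v. ?U \<alpha> u v) \<or> (\<exists>u v. ?U \<beta> u v)")
    case True
    then show ?thesis
    proof (cases "(\<exists>u v. ?U \<alpha> u v) \<and> (\<exists>u v. ?U \<beta> u v)")
      case True
      then show ?thesis using both by blast
    next
      case False
      \<comment> \<open>A colour without edges is replaced by the other one, so that
        \<open>both\<close> applies.\<close>
      with True consider "\<exists>u v. ?U \<alpha> u v" "\<not> (\<exists>u v. ?U \<beta> u v)" | "\<exists>u v. ?U \<beta> u v" "\<not> (\<exists>u v. ?U \<alpha> u v)" by blast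
      then show ?thesis
      proof cases
        case 1
        then have "?T \<alpha> \<alpha>" using both by blast
        then show ?thesis using 1(2) by blast
      next
        case 2
        then have "?T \<beta> \<beta>" using both by blast
        then show ?thesis using 2(2) by blast
      qed
    qed
  next
    case False
    then show ?thesis by (intro exI[of _ "\<lambda>_. 0"]) auto
  qed
  then obtain f :: "nat \<Rightarrow> nat" where "\<forall>v. f v < 3" "\<forall>u v. ?U \<alpha> u v \<or> ?U \<beta> u v \<longrightarrow> f u \<noteq> f v"
    by blast
  then show ?thesis by (intro exI[of _ f]) (auto simp: mubayi_adj_def)
qed

lemma card_le_2_subset_pair:
  assumes "finite A" "card A \<le> 2"
  obtains \<alpha> \<beta> where "A \<subseteq> {\<alpha>, \<beta>}"
proof -
  consider "card A = 0" | "card A = 1" | "card A = 2" using assms(2) by linarith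
  then show ?thesis
  proof cases
    case 1
    then show ?thesis using that[of undefined undefined] assms(1) by simp
  next
    case 2
    then obtain x where "A = {x}" by (rule card_1_singletonE)
    then show ?thesis using that[of x x] by simp
  next
    case 3
    then obtain x y where "A = {x, y}" by (auto simp: card_2_iff)
    then show ?thesis using that[of x y] by simp
  qed
qed

text \<open>Vertices are distinct points of a grid of size \<open>m ^ t\<close>. A set of
  coordinates and a pair of values leave at most 2^t m^2 colours, and encoding them injectively
  preserves the number of colours on a subgraph.\<close>

lemma mubayi_colouring:
  assumes n: "n \<le> m ^ t" and r: "2 ^ t * m\<^sup>2 \<le> r"
  shows "\<exists>c :: nat set \<Rightarrow> nat. c ` edges_of {..<n} \<subseteq> {..<r} \<and>
    (\<forall>V E. V \<subseteq> {..<n} \<longrightarrow> E \<subseteq> edges_of V \<longrightarrow> card (c ` E) \<le> 2 \<longrightarrow> chromatic_number V E \<le> 3)"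
proof -
  let ?F = "{..<t} \<rightarrow>\<^sub>E {..<m}"
  have "card {..<n} \<le> card ?F" using n by (simp add: card_funcsetE)
  then obtain g where g: "g ` {..<n} \<subseteq> ?F" "inj_on g {..<n}"
    using card_le_inj[of "{..<n}" ?F] finite_PiE[of "{..<t}" "\<lambda>_. {..<m}"] by auto
  have sep: "\<exists>j<t. g u j \<noteq> g v j" if "u \<in> {..<n}" "v \<in> {..<n}" "u \<noteq> v" for u v
  proof (rule ccontr)
    assume "\<not> ?thesis"
    then have "g u = g v" using g(1) that by (intro PiE_ext[of "g u" "{..<t}" "\<lambda>_. {..<m}" "g v"]) auto
    then show False using g(2) that by (auto dest: inj_onD)
  qed
  define R where "R = Pow {..<t} \<times> (\<lambda>(x, y). {x, y}) ` ({..<m} \<times> {..<m})"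
  have finR: "finite R" unfolding R_def by simp
  have "card R \<le> 2 ^ t * (m * m)"
    unfolding R_def card_cartesian_product
    using card_image_le[of "{..<m} \<times> {..<m}" "\<lambda>(x, y). {x, y}"] by (simp add: card_Pow)
  then have "card R \<le> card {..<r}" using r by (simp add: power2_eq_square)
  then obtain enc where enc: "enc ` R \<subseteq> {..<r}" "inj_on enc R"
    using card_le_inj[OF finR, of "{..<r}"] by auto
  have inR: "mubayi g t e \<in> R" if e: "e \<in> edges_of {..<n}" for e
  proof -
    obtain u v where uv: "e = {u, v}" "u < n" "v < n" "u \<noteq> v" using e unfolding edges_of_def by auto
    obtain D S where DS: "mubayi g t {u, v} = (D, S)" by fastforce
    have "\<exists>j<t. g u j \<noteq> g v j" using sep uv by simp
    note E = mubayi_edge[OF DS this]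
    have "g u (Min D) < m" "g v (Min D) < m" using g(1) uv E(1) by (auto simp: image_subset_iff PiE_iff)
    moreover have "D \<subseteq> {..<t}" using DS unfolding mubayi_def Let_def by auto
    ultimately show ?thesis unfolding uv(1) DS R_def E(4) by auto
  qed
  define c where "c = (\<lambda>e. enc (mubayi g t e))"
  have "c ` edges_of {..<n} \<subseteq> {..<r}" using inR enc(1) by (auto simp: c_def)
  moreover have "chromatic_number V E \<le> 3"
    if VE: "V \<subseteq> {..<n}" "E \<subseteq> edges_of V" "card (c ` E) \<le> 2" for V E
  proof -
    have En: "E \<subseteq> edges_of {..<n}" using VE unfolding edges_of_def by blast
    then have sub: "mubayi g t ` E \<subseteq> R" using inR by auto
    have "c ` E = enc ` (mubayi g t ` E)" by (auto simp: c_def)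
    then have "card (mubayi g t ` E) \<le> 2"
      using VE(3) card_image[OF inj_on_subset[OF enc(2) sub]] by simp
    then obtain \<alpha> \<beta> where ab: "mubayi g t ` E \<subseteq> {\<alpha>, \<beta>}"
      using card_le_2_subset_pair[OF finite_subset[OF sub finR]] by blast
    obtain f :: "nat \<Rightarrow> nat" where f: "\<forall>v. f v < 3"
      "\<forall>u v. u \<in> {..<n} \<and> v \<in> {..<n} \<and> u \<noteq> v \<and> mubayi g t {u, v} \<in> {\<alpha>, \<beta>} \<longrightarrow> f u \<noteq> f v"
      using mubayi_three_colouring[of "{..<n}" t g \<alpha> \<beta>] sep by blast
    have "proper_colouring V E f 3"
      unfolding proper_colouring_def
    proof (intro conjI allI impI)
      show "f ` V \<subseteq> {..<3}" using f(1) by auto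
      fix u v assume uv: "{u, v} \<in> E" "u \<noteq> v"
      then have "u \<in> {..<n}" "v \<in> {..<n}" using En edges_of_iff[of u v "{..<n}"] by auto
      moreover have "mubayi g t {u, v} \<in> {\<alpha>, \<beta>}" using ab uv by blast
      ultimately show "f u \<noteq> f v" using f(2) uv by blast
    qed
    then show ?thesis by (rule chromatic_number_le)
  qed
  ultimately show ?thesis by blast
qed

section \<open>The two bounds\<close>

text \<open>A union of two colours that is not 3-colourable would contain an induced subgraph of
  chromatic number exactly 4.\<close>

lemma pairs_3col_if_no_4chromatic:
  assumes no: "\<And>V E. V \<subseteq> {..<n} \<Longrightarrow> E \<subseteq> edges_of V \<Longrightarrow> card (c ` E) \<le> 2 \<Longrightarrow> chromatic_number V E \<noteq> 4"
  shows "pairs_3col (\<lambda>u v. c {u, v}) {..<n}"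
  unfolding pairs_3col_def
proof (intro allI)
  fix i k
  let ?V = "{..<n}" and ?E = "{e. c e \<in> {i, k}}"
  have "\<not> 4 \<le> chromatic_number ?V (?E \<inter> edges_of ?V)"
  proof
    assume "4 \<le> chromatic_number ?V (?E \<inter> edges_of ?V)"
    then obtain V' where V': "V' \<subseteq> ?V" "chromatic_number V' (?E \<inter> edges_of V') = 4"
      using induced_subgraph_of_chromatic_number[of ?V 4 ?E] by auto
    have "card (c ` (?E \<inter> edges_of V')) \<le> card {i, k}" by (intro card_mono) auto
    also have "\<dots> \<le> 2" by (cases "i = k") auto
    finally show False using no[OF V'(1), of "?E \<inter> edges_of V'"] V'(2) by auto
  qed
  then have chi: "chromatic_number ?V (?E \<inter> edges_of ?V) \<le> 3" by simp
  obtain f where f: "proper_colouring ?V (?E \<inter> edges_of ?V) f (chromatic_number ?V (?E \<inter> edges_of ?V))"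
    using chromatic_number_attained[of ?V] by blast
  show "\<exists>f::nat \<Rightarrow> nat. (\<forall>v\<in>?V. f v < 3) \<and>
      (\<forall>u\<in>?V. \<forall>v\<in>?V. u \<noteq> v \<longrightarrow> c {u, v} \<in> {i, k} \<longrightarrow> f u \<noteq> f v)"
  proof (intro exI[of _ f] conjI ballI impI)
    show "f v < 3" if "v \<in> ?V" for v using f chi that unfolding proper_colouring_def by force
    show "f u \<noteq> f v" if "u \<in> ?V" "v \<in> ?V" "u \<noteq> v" "c {u, v} \<in> {i, k}" for u v
    proof -
      have "{u, v} \<in> ?E \<inter> edges_of ?V" using that by (simp add: edges_of_iff)
      then show ?thesis using f that(3) unfolding proper_colouring_def by blast
    qed
  qed
qed

definition forces_4chromatic :: "nat \<Rightarrow> nat \<Rightarrow> bool" where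
  "forces_4chromatic r n \<longleftrightarrow> (\<forall>c :: nat set \<Rightarrow> nat. c ` edges_of {..<n} \<subseteq> {..<r} \<longrightarrow>
     (\<exists>V E. V \<subseteq> {..<n} \<and> E \<subseteq> edges_of V \<and> chromatic_number V E = 4 \<and> card (c ` E) \<le> 2))"

lemma F_chi_4_3: "F_chi r 4 3 = (LEAST n. forces_4chromatic r n)"
proof -
  have "(3::nat) - 1 = 2" by simp
  then show ?thesis unfolding F_chi_def forces_4chromatic_def by (simp only:)
qed

text \<open>This is \<open>card_bound\<close> with \<open>L = 1 + log 2 r\<close>, for which
  \<open>2 powr L\<close> equals 2r.\<close>

lemma forces_4chromatic_if_large:
  assumes r: "r \<ge> 1" and n: "2 powr (125 * sqrt (real r * (1 + log 2 (real r))) + 3200 * (1 + log 2 (real r))) < real n"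
  shows "forces_4chromatic r n"
  unfolding forces_4chromatic_def
proof (intro allI impI, rule ccontr)
  fix c :: "nat set \<Rightarrow> nat"
  assume c: "c ` edges_of {..<n} \<subseteq> {..<r}"
    and "\<not> (\<exists>V E. V \<subseteq> {..<n} \<and> E \<subseteq> edges_of V \<and> chromatic_number V E = 4 \<and> card (c ` E) \<le> 2)"
  then have col: "pairs_3col (\<lambda>u v. c {u, v}) {..<n}"
    by (intro pairs_3col_if_no_4chromatic) blast
  have "colours (\<lambda>u v. c {u, v}) {..<n} \<subseteq> {..<r}"
    using c unfolding colours_def by (auto simp: image_subset_iff edges_of_iff)
  then have "card (colours (\<lambda>u v. c {u, v}) {..<n}) \<le> r"
    using card_mono[of "{..<r}"] by force
  moreover have "1 \<le> 1 + log 2 (real r)" using r by simp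
  moreover have "2 * real r \<le> 2 powr (1 + log 2 (real r))" using r by (simp add: powr_add)
  ultimately have "real (card {..<n}) \<le> 2 powr (125 * sqrt (real r * (1 + log 2 (real r))) + 3200 * (1 + log 2 (real r)))"
    using col by (intro card_bound) auto
  then show False using n by simp
qed

text \<open>The grid with \<open>t = 2 * s\<close> coordinates and \<open>m = 2 ^ s\<close> values
  has 2^(2 s^2) points and at most 2^(4s) colours.\<close>

lemma not_forces_4chromatic_if_small:
  assumes "4 * real s \<le> log 2 (real r)" "r \<ge> 1" "n \<le> 2 ^ (2 * s\<^sup>2)"
  shows "\<not> forces_4chromatic r n"
proof -
  have n: "n \<le> (2 ^ s) ^ (2 * s)" using assms(3) by (simp add: power_mult[symmetric] power2_eq_square mult_ac)
  have "real (2 ^ (2 * s) * (2 ^ s)\<^sup>2) = 2 powr (4 * real s)"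
    by (simp add: powr_realpow[symmetric] power_mult[symmetric] powr_add[symmetric])
  also have "\<dots> \<le> 2 powr log 2 (real r)" using assms(1) by (intro powr_mono) auto
  also have "\<dots> = real r" using assms(2) by simp
  finally have "2 ^ (2 * s) * (2 ^ s)\<^sup>2 \<le> r" by (simp only: of_nat_le_iff)
  from mubayi_colouring[OF n this] obtain c :: "nat set \<Rightarrow> nat" where c: "c ` edges_of {..<n} \<subseteq> {..<r}"
    "\<And>V E. V \<subseteq> {..<n} \<Longrightarrow> E \<subseteq> edges_of V \<Longrightarrow> card (c ` E) \<le> 2 \<Longrightarrow> chromatic_number V E \<le> 3" by blast
  show ?thesis
  proof
    assume "forces_4chromatic r n"
    then obtain V E where VE: "V \<subseteq> {..<n}" "E \<subseteq> edges_of V" "chromatic_number V E = 4" "card (c ` E) \<le> 2"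
      using c(1) unfolding forces_4chromatic_def by meson
    then show False using c(2)[OF VE(1,2,4)] by simp
  qed
qed

theorem theorem1p6:
  shows "\<exists>C::real. C > 0 \<and> (\<exists>r0::nat. r0 > 0 \<and> (\<forall>r::nat. r \<ge> r0 \<longrightarrow>
           2 powr ((log 2 (real r))\<^sup>2 / 36) \<le> real (F_chi r 4 3) \<and>
           real (F_chi r 4 3) \<le> C * 2 powr (130 * sqrt (real r * log 2 (real r)))))"
proof -
  \<comment> \<open>Raising 125 to 130 absorbs the 1 beside the logarithm and the lower-order
    summand.\<close>
  have "eventually (\<lambda>r::nat. 125 * sqrt (real r * (1 + log 2 (real r))) + 3200 * (1 + log 2 (real r))
      \<le> 130 * sqrt (real r * log 2 (real r))) at_top"
    by real_asymp
  then obtain r1 where r1: "\<And>r::nat. r \<ge> r1 \<Longrightarrow>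
      125 * sqrt (real r * (1 + log 2 (real r))) + 3200 * (1 + log 2 (real r)) \<le> 130 * sqrt (real r * log 2 (real r))"
    unfolding eventually_at_top_linorder by blast
  have main: "2 powr ((log 2 (real r))\<^sup>2 / 36) \<le> real (F_chi r 4 3) \<and>
      real (F_chi r 4 3) \<le> 2 * 2 powr (130 * sqrt (real r * log 2 (real r)))"
    if r: "r \<ge> max r1 256" for r
  proof -
    define l where "l = log 2 (real r)"
    define B where "B = 2 powr (130 * sqrt (real r * l))"
    have l: "l \<ge> 8" unfolding l_def using r by (simp add: le_log_iff)
    \<comment> \<open>The first integer above \<open>B\<close>; it is at most \<open>2 * B\<close>
      because \<open>B\<close> is at least 1, whence the constant 2.\<close>
    define n where "n = nat \<lfloor>B\<rfloor> + 1"
    have B1: "B \<ge> 1" unfolding B_def using l by (intro ge_one_powr_ge_zero) auto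
    have "2 powr (125 * sqrt (real r * (1 + l)) + 3200 * (1 + l)) \<le> B"
      unfolding B_def l_def using r1[of r] r by (intro powr_mono) auto
    also have "B < real n" unfolding n_def using B1 by linarith
    finally have fn: "forces_4chromatic r n"
      unfolding l_def using r by (intro forces_4chromatic_if_large) auto
    have "F_chi r 4 3 \<le> n" unfolding F_chi_4_3 by (rule Least_le[of "forces_4chromatic r", OF fn])
    also have "real n \<le> 2 * B" unfolding n_def using B1 by linarith
    finally have up: "real (F_chi r 4 3) \<le> 2 * B" by simp
    \<comment> \<open>The existence of \<open>n\<close> makes the \<open>LEAST\<close> a genuine
      minimum, on which the lower bound relies.\<close>
    have F: "forces_4chromatic r (F_chi r 4 3)" unfolding F_chi_4_3 by (rule LeastI[of "forces_4chromatic r", OF fn])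
    \<comment> \<open>As \<open>l\<close> is at least 8, rounding down costs at most a factor 2. So
      2 s^2 is at least l^2 / 32, which is more than l^2 / 36.\<close>
    define s where "s = nat \<lfloor>l / 4\<rfloor>"
    have s: "4 * real s \<le> l" "l / 8 \<le> real s" unfolding s_def using l by linarith+
    have "\<not> F_chi r 4 3 \<le> 2 ^ (2 * s\<^sup>2)"
      using not_forces_4chromatic_if_small[of s r] s(1) F r unfolding l_def by auto
    then have "(2::real) ^ (2 * s\<^sup>2) \<le> real (F_chi r 4 3)"
      by (metis less_imp_le not_le of_nat_le_iff of_nat_numeral of_nat_power)
    moreover have "2 powr (l\<^sup>2 / 36) \<le> 2 ^ (2 * s\<^sup>2)"
    proof -
      have "(l / 8)\<^sup>2 \<le> (real s)\<^sup>2" using s l by (intro power_mono) auto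
      then have "l\<^sup>2 / 64 \<le> (real s)\<^sup>2" by (simp add: power_divide)
      moreover have "0 \<le> l\<^sup>2" "real (2 * s\<^sup>2) = 2 * (real s)\<^sup>2" by simp_all
      ultimately have "l\<^sup>2 / 36 \<le> real (2 * s\<^sup>2)" by linarith
      then have "2 powr (l\<^sup>2 / 36) \<le> 2 powr real (2 * s\<^sup>2)" by (intro powr_mono) auto
      then show ?thesis by (simp only: powr_realpow zero_less_numeral)
    qed
    ultimately have "2 powr (l\<^sup>2 / 36) \<le> real (F_chi r 4 3)" by linarith
    with up show ?thesis unfolding B_def l_def by blast
  qed
  show ?thesis
    by (rule exI[of _ 2], intro conjI exI[of _ "max r1 256"] allI impI main) auto
qed

end
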